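(* Assume that the capacity $I(P_X^*,P_{Y|X})$ is finite. Then for any positive definite $M\in\mathbb R^{d\times d}$, $M\succ0$, and $P_Y$-almost all $y$, the problem $$\mathcal L(P_{W|Y=y},P_W,c_M):\quad \inf_{S:\,S\#P_{W|Y=y}=P_W}\int_{\mathsf W}(u-S(u))^TM(u-S(u))\,P_{W|Y=y}(du)$$ has a unique optimal solution $S_y$ that is invertible.
   Context: $\mathsf W,\mathsf X\subset\mathbb R^d$ and $\mathsf Y$ are (subsets of) Euclidean spaces with Borel $\sigma$-algebras; $\mathsf W$ is open, bounded and convex. $P_W$ is the uniform distribution on $\mathsf W$. $P_{Y|X}$ is a transition kernel from $\mathsf X$ to $\mathsf Y$, and $P_X^*$ is a maximizer of the mutual information $I(P_X,P_{Y|X})$ over probability measures $P_X$ on $\mathsf X$ with $\mathbb E_{P_X}[\eta(X)]\le L$, for a given cost $\eta:\mathsf X\to\mathbb R_+$ and $L$. $\phi:\mathsf W\to\mathsf X$ is a measurable map with $\phi\#P_W=P_X^*$; $W\sim P_W$, $X=\phi(W)$, and $Y$ has conditional law $P_{Y|X}(\cdot|\phi(W))$ given $W$. $P_Y$ is the law of $Y$, and $P_{W|Y=y}$ is the (regular) conditional law of $W$ given $Y=y$. $S\#P=Q$ means that the Borel map $S:\mathsf W\to\mathsf W$ pushes $P$ forward to $Q$. As usual in optimal transport, maps agreeing $P_{W|Y=y}$-almost everywhere are identified when speaking of uniqueness. *)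

theory Defs
  imports "HOL-Probability.Probability"
begin

abbreviation borel_on :: "'a::topological_space set \<Rightarrow> 'a measure" where
  "borel_on A \<equiv> restrict_space borel A"

text \<open>Uniform distribution, as a measure whose underlying space is \<open>W\<close> itself.\<close>

definition uniform_on :: "'a::euclidean_space set \<Rightarrow> 'a measure" where
  "uniform_on W = uniform_measure (restrict_space lborel W) W"

text \<open>
  The library's \<open>KL_divergence\<close> is a real-valued Bochner integral, so it does not express
  finiteness.  For probability measures \<open>P \<lless> Q\<close> the negative part of \<open>log (dP/dQ)\<close> is always
  \<open>P\<close>-integrable, so non-integrability of \<open>log (dP/dQ)\<close> means that the divergence is \<open>\<infinity>\<close>.
  Note the argument order of the library functions: the reference measure \<open>Q\<close> comes first.
\<close>

definition relative_entropy :: "'a measure \<Rightarrow> 'a measure \<Rightarrow> ereal" where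
  "relative_entropy P Q =
     (if absolutely_continuous Q P \<and> integrable P (entropy_density (exp 1) Q P)
      then ereal (KL_divergence (exp 1) Q P) else \<infinity>)"

text \<open>\<open>joint_law P N K\<close> is \<open>P(dx) K(dy|x)\<close> on \<open>P \<Otimes>\<^sub>M N\<close>, for a kernel \<open>K\<close> into \<open>N\<close>;
  \<open>output_law P K\<close> is its second marginal.\<close>

definition joint_law :: "'a measure \<Rightarrow> 'b measure \<Rightarrow> ('a \<Rightarrow> 'b measure) \<Rightarrow> ('a \<times> 'b) measure" where
  "joint_law P N K = P \<bind> (\<lambda>x. distr (K x) (P \<Otimes>\<^sub>M N) (Pair x))"

definition output_law :: "'a measure \<Rightarrow> ('a \<Rightarrow> 'b measure) \<Rightarrow> 'b measure" where
  "output_law P K = P \<bind> K"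

definition mutual_info :: "'a measure \<Rightarrow> 'b measure \<Rightarrow> ('a \<Rightarrow> 'b measure) \<Rightarrow> ereal" where
  "mutual_info P N K = relative_entropy (joint_law P N K) (P \<Otimes>\<^sub>M output_law P K)"

definition admissible_inputs :: "'a measure \<Rightarrow> ('a \<Rightarrow> real) \<Rightarrow> real \<Rightarrow> 'a measure set" where
  "admissible_inputs N \<eta> L =
     {P. prob_space P \<and> sets P = sets N \<and> integrable P \<eta> \<and> (\<integral>x. \<eta> x \<partial>P) \<le> L}"

definition capacity_achieving ::
    "'a measure \<Rightarrow> 'b measure \<Rightarrow> ('a \<Rightarrow> 'b measure) \<Rightarrow> ('a \<Rightarrow> real) \<Rightarrow> real \<Rightarrow> 'a measure \<Rightarrow> bool" where
  "capacity_achieving NX NY K \<eta> L P \<longleftrightarrow>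
     P \<in> admissible_inputs NX \<eta> L \<and>
     (\<forall>P'\<in>admissible_inputs NX \<eta> L. mutual_info P' NY K \<le> mutual_info P NY K)"

text \<open>\<open>Q\<close> is a regular conditional law of the first coordinate given the second one, for a
  joint law \<open>J\<close> on \<open>N1 \<Otimes>\<^sub>M N2\<close>.\<close>

definition regular_cond_law ::
    "'a measure \<Rightarrow> 'b measure \<Rightarrow> ('a \<times> 'b) measure \<Rightarrow> ('b \<Rightarrow> 'a measure) \<Rightarrow> bool" where
  "regular_cond_law N1 N2 J Q \<longleftrightarrow>
     Q \<in> N2 \<rightarrow>\<^sub>M prob_algebra N1 \<and>
     (\<forall>A\<in>sets N1. \<forall>B\<in>sets N2.
        emeasure J (A \<times> B) = (\<integral>\<^sup>+y\<in>B. emeasure (Q y) A \<partial>distr J N2 snd))"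

text \<open>Symmetry of \<open>M\<close> is not required; symmetric positive definite matrices are a special case.\<close>

definition pos_def :: "real ^ 'n ^ 'n \<Rightarrow> bool" where
  "pos_def M \<longleftrightarrow> (\<forall>x. x \<noteq> 0 \<longrightarrow> 0 < x \<bullet> (M *v x))"

definition quad_cost :: "real ^ 'n ^ 'n \<Rightarrow> real ^ 'n \<Rightarrow> real ^ 'n \<Rightarrow> real" where
  "quad_cost M u v = (u - v) \<bullet> (M *v (u - v))"

definition transport_maps :: "'a measure \<Rightarrow> 'b measure \<Rightarrow> ('a \<Rightarrow> 'b) set" where
  "transport_maps \<mu> \<nu> = {S. S \<in> \<mu> \<rightarrow>\<^sub>M \<nu> \<and> distr \<mu> \<nu> S = \<nu>}"

definition transport_cost :: "('a \<Rightarrow> 'b \<Rightarrow> real) \<Rightarrow> 'a measure \<Rightarrow> ('a \<Rightarrow> 'b) \<Rightarrow> ennreal" where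
  "transport_cost c \<mu> S = (\<integral>\<^sup>+u. ennreal (c u (S u)) \<partial>\<mu>)"

definition optimal_map ::
    "('a \<Rightarrow> 'b \<Rightarrow> real) \<Rightarrow> 'a measure \<Rightarrow> 'b measure \<Rightarrow> ('a \<Rightarrow> 'b) \<Rightarrow> bool" where
  "optimal_map c \<mu> \<nu> S \<longleftrightarrow>
     S \<in> transport_maps \<mu> \<nu> \<and>
     transport_cost c \<mu> S = (INF T\<in>transport_maps \<mu> \<nu>. transport_cost c \<mu> T)"

text \<open>Invertibility as a Borel map of \<open>W\<close> onto itself.  An optimal map is determined only up to
  a null set of the source measure, so this is a condition on the choice of representative.\<close>

definition borel_invertible_on :: "'a::topological_space set \<Rightarrow> ('a \<Rightarrow> 'a) \<Rightarrow> bool" where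
  "borel_invertible_on W S \<longleftrightarrow>
     bij_betw S W W \<and> S \<in> borel_on W \<rightarrow>\<^sub>M borel_on W \<and>
     the_inv_into W S \<in> borel_on W \<rightarrow>\<^sub>M borel_on W"

end

theory Submission
  imports Defs "HOL-Complex_Analysis.Great_Picard"
begin

text \<open>
  Finite mutual information makes the joint law of \<open>(X, Y)\<close> absolutely continuous with respect to
  the product of its marginals.  Hence almost every posterior \<open>P_{W|Y=y}\<close> has a density, and the
  claim becomes Brenier's theorem between two absolutely continuous measures on a bounded set.

  Up to terms that only depend on the marginals, the cost is \<open>- u \<bullet> A v\<close> with
  \<open>A = M + transpose M\<close>.  A minimizer of the dual problem exists by Arzela-Ascoli.  The
  supremum that defines the \<open>A\<close>-conjugate of a continuous function is attained at exactly one point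
  for almost every argument, and the first variation of the dual functional says that the resulting
  map pushes one measure to the other.
  Equality in the duality inequality gives optimality and uniqueness, and the conjugate potential
  gives the inverse map almost everywhere.  To obtain a genuine Borel bijection of \<open>W\<close>, the map is
  changed on a null set that contains a Borel copy of the whole space, by a Hilbert hotel argument.
\<close>

section \<open>Borel isomorphisms and null sets\<close>

definition borel_iso_on ::
    "'a::topological_space set \<Rightarrow> 'a set \<Rightarrow> ('a \<Rightarrow> 'a) \<Rightarrow> ('a \<Rightarrow> 'a) \<Rightarrow> bool" where
  "borel_iso_on P Q F G \<longleftrightarrow> F \<in> borel \<rightarrow>\<^sub>M borel \<and> G \<in> borel \<rightarrow>\<^sub>M borel \<and> F \<in> P \<rightarrow> Q \<and> G \<in> Q \<rightarrow> P \<and>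
     (\<forall>x\<in>P. G (F x) = x) \<and> (\<forall>y\<in>Q. F (G y) = y)"

definition borel_embedding :: "'a::euclidean_space set \<Rightarrow> ('a \<Rightarrow> 'a) \<Rightarrow> ('a \<Rightarrow> 'a) \<Rightarrow> bool" where
  "borel_embedding Z e d \<longleftrightarrow> e \<in> borel \<rightarrow>\<^sub>M borel \<and> d \<in> borel \<rightarrow>\<^sub>M borel \<and> range e \<subseteq> Z \<and> (\<forall>x. d (e x) = x)"

lemma borel_embedding_image:
  assumes "borel_embedding Z e d" and [measurable]: "S \<in> sets borel"
  shows "e ` S \<in> sets borel"
proof -
  have [measurable]: "e \<in> borel \<rightarrow>\<^sub>M borel" "d \<in> borel \<rightarrow>\<^sub>M borel" and de: "d (e x) = x" for x
    using assms(1) by (auto simp: borel_embedding_def)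
  have "e ` S = {z. e (d z) = z \<and> d z \<in> S}" using de by force
  also have "\<dots> \<in> sets borel" by measurable
  finally show ?thesis .
qed

text \<open>Hilbert's hotel: \<open>C\<close> collects the points of \<open>P - e ` Q\<close> and their images under the even
  iterates of \<open>e\<close>; the bijection applies \<open>e\<close> on \<open>C\<close> and undoes it elsewhere.\<close>

lemma borel_hilbert_hotel:
  fixes P Q Z :: "'a::euclidean_space set" and e d :: "'a \<Rightarrow> 'a"
  assumes P: "P \<in> sets borel" and Q: "Q \<in> sets borel" and Z: "Z \<subseteq> P" "Z \<subseteq> Q"
    and emb: "borel_embedding Z e d"
  obtains F G where "borel_iso_on P Q F G"
proof -
  have e: "e \<in> borel \<rightarrow>\<^sub>M borel" and d: "d \<in> borel \<rightarrow>\<^sub>M borel" and eZ: "range e \<subseteq> Z"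
    and de: "d (e x) = x" for x
    using emb by (auto simp: borel_embedding_def)
  note im = borel_embedding_image[OF emb]
  define C where "C = (\<Union>n. ((\<lambda>S. e ` e ` S) ^^ n) (P - e ` Q))"
  have "((\<lambda>S. e ` e ` S) ^^ n) (P - e ` Q) \<in> sets borel" for n
    by (induction n) (use P Q im in auto)
  then have C: "C \<in> sets borel" unfolding C_def by auto
  have base: "x \<in> C" if "x \<in> P" "x \<notin> e ` Q" for x
    unfolding C_def using that by (intro UN_I[of 0]) auto
  have step: "e (e x) \<in> C" if "x \<in> C" for x
  proof -
    from that obtain n where "x \<in> ((\<lambda>S. e ` e ` S) ^^ n) (P - e ` Q)" unfolding C_def by auto
    then show ?thesis unfolding C_def by (intro UN_I[of "Suc n"]) auto
  qed
  have inv: "x \<in> P - e ` Q \<or> (\<exists>c\<in>C. x = e (e c))" if "x \<in> C" for x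
  proof -
    from that obtain n where n: "x \<in> ((\<lambda>S. e ` e ` S) ^^ n) (P - e ` Q)" unfolding C_def by auto
    show ?thesis
    proof (cases n)
      case 0
      then show ?thesis using n by auto
    next
      case (Suc m)
      then obtain c where "c \<in> ((\<lambda>S. e ` e ` S) ^^ m) (P - e ` Q)" "x = e (e c)" using n by auto
      then show ?thesis unfolding C_def by auto
    qed
  qed
  have e_inj: "e x = e y \<longleftrightarrow> x = y" for x y using de by metis
  have eP: "e x \<in> P" "e x \<in> Q" for x using eZ Z by auto
  define F where "F x = (if x \<in> C then e x else d x)" for x
  define G where "G y = (if y \<in> e ` C then d y else e y)" for y
  have "borel_iso_on P Q F G"
    unfolding borel_iso_on_def
  proof (intro conjI ballI)
    show "F \<in> borel \<rightarrow>\<^sub>M borel" unfolding F_def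
      using C by (intro measurable_If e d) auto
    show "G \<in> borel \<rightarrow>\<^sub>M borel" unfolding G_def
      using im[OF C] by (intro measurable_If e d) auto
    have CP: "x \<in> P" if "x \<in> C" for x using inv[OF that] eP by auto
    show "F \<in> P \<rightarrow> Q" using base eP de by (force simp: F_def)
    show "G \<in> Q \<rightarrow> P" using CP eP de by (force simp: G_def)
    show "G (F x) = x" if x: "x \<in> P" for x
    proof (cases "x \<in> C")
      case True
      then show ?thesis by (simp add: F_def G_def de)
    next
      case False
      then obtain y where y: "y \<in> Q" "x = e y" using base x by auto
      have "y \<notin> e ` C" using False y step by auto
      then show ?thesis using False y by (simp add: F_def G_def de)
    qed
    show "F (G y) = y" if y: "y \<in> Q" for y
    proof (cases "y \<in> e ` C")
      case True
      then show ?thesis by (auto simp: F_def G_def de)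
    next
      case False
      have "e y \<notin> C"
      proof
        assume "e y \<in> C"
        then consider "e y \<notin> e ` Q" | c where "c \<in> C" "e y = e (e c)" using inv by blast
        then show False using y False by cases (auto simp: e_inj)
      qed
      then show ?thesis using False by (simp add: F_def G_def de)
    qed
  qed
  then show ?thesis by (rule that)
qed

fun ternary_digit :: "nat \<Rightarrow> real \<Rightarrow> bool" where
  "ternary_digit 0 x \<longleftrightarrow> 1 / 3 \<le> x"
| "ternary_digit (Suc n) x = ternary_digit n (3 * x - of_bool (1 / 3 \<le> x))"

definition cantor_sum :: "(nat \<Rightarrow> bool) \<Rightarrow> real" where
  "cantor_sum b = (\<Sum>n. of_bool (b n) * (1 / 3) ^ Suc n)"

lemma summable_cantor: "summable (\<lambda>n. of_bool (b n) * (1 / 3 :: real) ^ Suc n)"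
proof (rule summable_comparison_test')
  show "summable (\<lambda>n. (1 / 3 :: real) ^ Suc n)"
    unfolding power_Suc by (intro summable_mult summable_geometric) simp
  show "norm (of_bool (b n) * (1 / 3 :: real) ^ Suc n) \<le> (1 / 3) ^ Suc n" if "0 \<le> n" for n
    by (cases "b n") simp_all
qed

lemma cantor_sum_bounds: "0 \<le> cantor_sum b" "cantor_sum b \<le> 1 / 2"
proof -
  have g: "(\<lambda>n. (1 / 3 :: real) ^ Suc n) sums (1 / 3 * (1 / (1 - 1 / 3)))"
    unfolding power_Suc by (intro sums_mult geometric_sums) auto
  have "cantor_sum b \<le> (\<Sum>n. (1 / 3 :: real) ^ Suc n)"
    unfolding cantor_sum_def using summable_cantor sums_summable[OF g]
    by (intro suminf_le) (auto simp: of_bool_def)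
  then show "cantor_sum b \<le> 1 / 2" using sums_unique[OF g] by simp
  show "0 \<le> cantor_sum b"
    unfolding cantor_sum_def by (intro suminf_nonneg summable_cantor) auto
qed

lemma cantor_sum_Suc: "3 * cantor_sum b = of_bool (b 0) + cantor_sum (\<lambda>n. b (Suc n))"
proof -
  have "cantor_sum b = of_bool (b 0) / 3 + (\<Sum>n. of_bool (b (Suc n)) * (1 / 3) ^ Suc (Suc n))"
    unfolding cantor_sum_def using suminf_split_head[OF summable_cantor[of b]] by simp
  also have "(\<Sum>n. of_bool (b (Suc n)) * (1 / 3) ^ Suc (Suc n)) = (1 / 3) * cantor_sum (\<lambda>n. b (Suc n))"
    unfolding cantor_sum_def by (subst suminf_mult[OF summable_cantor, symmetric]) (simp add: mult_ac)
  finally show ?thesis by simp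
qed

lemma ternary_digit_cantor_sum: "ternary_digit n (cantor_sum b) = b n"
proof (induction n arbitrary: b)
  case 0
  show ?case using cantor_sum_Suc[of b] cantor_sum_bounds[of "\<lambda>n. b (Suc n)"] by (cases "b 0") auto
next
  case (Suc n)
  have "(1 / 3 \<le> cantor_sum b) = b 0"
    using cantor_sum_Suc[of b] cantor_sum_bounds[of "\<lambda>n. b (Suc n)"] by (cases "b 0") auto
  then show ?case using Suc[of "\<lambda>n. b (Suc n)"] cantor_sum_Suc[of b] by simp
qed

lemma measurable_ternary_digit[measurable]: "Measurable.pred borel (ternary_digit n)"
proof (induction n)
  case (Suc n)
  note Suc[measurable]
  have "(\<lambda>x::real. 3 * x - of_bool (1 / 3 \<le> x)) \<in> borel \<rightarrow>\<^sub>M borel"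
    unfolding of_bool_def by measurable
  from measurable_compose[OF this Suc] show ?case by simp
qed simp

lemma measurable_cantor_sum:
  assumes [measurable]: "\<And>n. Measurable.pred M (\<lambda>x. b x n)"
  shows "(\<lambda>x. cantor_sum (b x)) \<in> borel_measurable M"
proof -
  have "(\<lambda>x. of_bool (b x n) * (1 / 3 :: real) ^ Suc n) \<in> borel_measurable M" for n
  proof -
    have "(\<lambda>x. if b x n then (1 / 3 :: real) ^ Suc n else 0) \<in> borel_measurable M"
      by measurable
    also have "(\<lambda>x. if b x n then (1 / 3 :: real) ^ Suc n else 0)
        = (\<lambda>x. of_bool (b x n) * (1 / 3) ^ Suc n)"
      by auto
    finally show ?thesis .
  qed
  then show ?thesis unfolding cantor_sum_def by (rule borel_measurable_suminf)
qed

lemma ex_borel_embedding_real: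
  obtains p :: "'c::euclidean_space \<Rightarrow> real" and u
  where "p \<in> borel_measurable borel" "u \<in> borel_measurable borel" "\<And>x. u (p x) = x"
    "\<And>x. 0 \<le> p x \<and> p x \<le> 1 / 2"
proof -
  define r :: "nat \<Rightarrow> real" where "r n = real_of_rat (from_nat n)" for n
  define bit :: "'c \<Rightarrow> nat \<Rightarrow> bool" where
    "bit x k = (case prod_decode k of (a, n) \<Rightarrow> r n < x \<bullet> from_nat_into Basis a)" for x k
  define p where "p x = cantor_sum (bit x)" for x
  define co where "co a z = real_of_ereal (SUP n. if ternary_digit (prod_encode (a, n)) z then ereal (r n) else - \<infinity>)"
    for a z
  define u :: "real \<Rightarrow> 'c" where "u z = (\<Sum>b\<in>Basis. co (to_nat_on Basis b) z *\<^sub>R b)" for z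
  have "Measurable.pred borel (\<lambda>x. bit x k)" for k
    unfolding bit_def by (cases "prod_decode k") simp
  then have p: "p \<in> borel_measurable borel" unfolding p_def by (rule measurable_cantor_sum)
  have u: "u \<in> borel_measurable borel" unfolding u_def co_def by measurable
  have co: "co a (p x) = x \<bullet> from_nat_into Basis a" for a x
  proof -
    let ?y = "x \<bullet> from_nat_into Basis a"
    have dig: "ternary_digit (prod_encode (a, n)) (p x) \<longleftrightarrow> r n < ?y" for n
      unfolding p_def ternary_digit_cantor_sum bit_def by simp
    have "(SUP n. if r n < ?y then ereal (r n) else - \<infinity>) = ereal ?y"
    proof (rule antisym)
      show "(SUP n. if r n < ?y then ereal (r n) else - \<infinity>) \<le> ereal ?y"
        by (intro SUP_least) auto
      show "ereal ?y \<le> (SUP n. if r n < ?y then ereal (r n) else - \<infinity>)"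
      proof (rule le_SUP_iff[THEN iffD2], intro allI impI)
        fix z :: ereal assume "z < ereal ?y"
        then obtain w where w: "z < ereal w" "w < ?y"
          by (metis ereal_dense2 less_ereal.simps(1))
        obtain q where q: "w < real_of_rat q" "real_of_rat q < ?y"
          using of_rat_dense[OF w(2)] by blast
        have "r (to_nat q) = real_of_rat q" by (simp add: r_def)
        then show "\<exists>i\<in>UNIV. z < (if r i < ?y then ereal (r i) else - \<infinity>)"
          using w q by (intro bexI[of _ "to_nat q"]) (auto intro: less_trans)
      qed
    qed
    then show ?thesis unfolding co_def dig by simp
  qed
  have "u (p x) = x" for x
  proof -
    have "u (p x) = (\<Sum>b\<in>Basis. (x \<bullet> b) *\<^sub>R b)"
      unfolding u_def co by (intro sum.cong) (auto simp: countable_finite)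
    then show ?thesis by (simp add: euclidean_representation)
  qed
  then show ?thesis using that[OF p u] cantor_sum_bounds unfolding p_def by blast
qed

text \<open>A Borel copy of the whole space inside a set that is null for two given measures: among the
  uncountably many disjoint slices of a Borel copy of \<open>'a \<times> real\<close>, only countably many are charged.\<close>

lemma ex_null_borel_embedding:
  fixes W :: "'a::euclidean_space set"
  assumes W: "open W" "W \<noteq> {}" and \<mu>: "finite_measure \<mu>" "sets \<mu> = sets borel"
    and \<nu>: "finite_measure \<nu>" "sets \<nu> = sets borel"
  obtains Z e d where "Z \<in> sets borel" "Z \<subseteq> W" "Z \<in> null_sets \<mu>" "Z \<in> null_sets \<nu>"
    "borel_embedding Z e d"
proof -
  interpret \<mu>: finite_measure \<mu> by fact
  interpret \<nu>: finite_measure \<nu> by fact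
  note [measurable_cong] = \<mu>(2) \<nu>(2)
  obtain p :: "'a \<times> real \<Rightarrow> real" and u where pu[measurable]: "p \<in> borel_measurable borel" "u \<in> borel_measurable borel"
    and up: "\<And>x. u (p x) = x" and p: "\<And>x. 0 \<le> p x \<and> p x \<le> 1 / 2"
    by (rule ex_borel_embedding_real) blast
  obtain w r where r: "0 < r" "ball w r \<subseteq> W" using W open_contains_ball by blast
  obtain b :: 'a where b: "b \<in> Basis" using nonempty_Basis by blast
  define E where "E x = w + (r * p x) *\<^sub>R b" for x
  define D where "D z = u ((z - w) \<bullet> b / r)" for z
  have [measurable]: "E \<in> borel_measurable borel" "D \<in> borel_measurable borel"
    unfolding E_def D_def by measurable
  have DE: "D (E x) = x" for x
    unfolding D_def E_def using b r up by simp
  have EW: "E x \<in> W" for x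
  proof -
    have "norm (E x - w) = r * p x" unfolding E_def using b r p[of x] by simp
    also have "\<dots> < r" using r p[of x] by (smt (verit) field_sum_of_halves mult_less_cancel_left2 half_gt_zero)
    finally show ?thesis using r by (auto simp: dist_norm norm_minus_commute)
  qed
  have proj: "fst \<in> borel_measurable (borel :: ('a \<times> real) measure)"
    "snd \<in> borel_measurable (borel :: ('a \<times> real) measure)"
    by (intro borel_measurable_continuous_onI continuous_intros)+
  have sD[measurable]: "(\<lambda>z. snd (D z)) \<in> borel_measurable borel"
    by (rule measurable_compose[OF \<open>D \<in> borel_measurable borel\<close> proj(2)])
  define \<mu>' where "\<mu>' = distr \<mu> borel (\<lambda>z. snd (D z))"
  define \<nu>' where "\<nu>' = distr \<nu> borel (\<lambda>z. snd (D z))"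
  interpret \<mu>': finite_measure \<mu>' unfolding \<mu>'_def by (intro \<mu>.finite_measure_distr) simp
  interpret \<nu>': finite_measure \<nu>' unfolding \<nu>'_def by (intro \<nu>.finite_measure_distr) simp
  have "countable ({x. measure \<mu>' {x} \<noteq> 0} \<union> {x. measure \<nu>' {x} \<noteq> 0})"
    using \<mu>'.countable_support \<nu>'.countable_support by auto
  then obtain t where t: "measure \<mu>' {t} = 0" "measure \<nu>' {t} = 0"
    using uncountable_UNIV_real by (metis (mono_tags, lifting) UNIV_eq_I Un_iff mem_Collect_eq)
  define Z where "Z = W \<inter> {z. snd (D z) = t}"
  define e where "e x = E (x, t)" for x
  define d where "d z = fst (D z)" for z
  have Wm[measurable]: "W \<in> sets borel" using W by simp
  have Z: "Z \<in> sets borel" unfolding Z_def by measurable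
  have "(\<lambda>x. (x, t)) \<in> borel_measurable (borel :: 'a measure)"
    by (intro borel_measurable_continuous_onI continuous_intros)
  from measurable_compose[OF this \<open>E \<in> borel_measurable borel\<close>]
  have em[measurable]: "e \<in> borel \<rightarrow>\<^sub>M borel" "d \<in> borel \<rightarrow>\<^sub>M borel"
    unfolding e_def d_def by (auto intro: measurable_compose[OF \<open>D \<in> borel_measurable borel\<close> proj(1)])
  have de: "d (e x) = x" for x by (simp add: d_def e_def DE)
  show ?thesis
  proof (rule that[OF Z])
    show "Z \<subseteq> W" by (auto simp: Z_def)
    show "borel_embedding Z e d"
      using em EW DE de by (auto simp: borel_embedding_def Z_def e_def)
    have "{z. snd (D z) = t} \<in> null_sets \<mu>"
    proof -
      have "emeasure \<mu>' {t} = emeasure \<mu> {z. snd (D z) = t}"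
        unfolding \<mu>'_def by (subst emeasure_distr) (auto simp: vimage_def sets_eq_imp_space_eq[OF \<mu>(2)])
      then show ?thesis using t(1) by (auto simp: \<mu>'.emeasure_eq_measure null_sets_def)
    qed
    then show "Z \<in> null_sets \<mu>" unfolding Z_def using Wm \<mu> by (auto intro: null_set_Int1)
    have "{z. snd (D z) = t} \<in> null_sets \<nu>"
    proof -
      have "emeasure \<nu>' {t} = emeasure \<nu> {z. snd (D z) = t}"
        unfolding \<nu>'_def by (subst emeasure_distr) (auto simp: vimage_def sets_eq_imp_space_eq[OF \<nu>(2)])
      then show ?thesis using t(2) by (auto simp: \<nu>'.emeasure_eq_measure null_sets_def)
    qed
    then show "Z \<in> null_sets \<nu>" unfolding Z_def using Wm \<nu> by (auto intro: null_set_Int1)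
  qed
qed

lemma extend_borel_iso:
  fixes W :: "'a::euclidean_space set"
  assumes W: "open W" "W \<noteq> {}" and \<mu>: "finite_measure \<mu>" "sets \<mu> = sets borel"
    and \<nu>: "finite_measure \<nu>" "sets \<nu> = sets borel" and iso: "borel_iso_on D E T R"
    and distr: "distr \<mu> borel T = \<nu>"
    and D: "D \<in> sets borel" "D \<subseteq> W" "AE u in \<mu>. u \<in> D" and E: "E \<in> sets borel" "E \<subseteq> W"
  obtains S S' where "borel_iso_on W W S S'" "AE u in \<mu>. S u = T u"
proof -
  have T: "T \<in> borel \<rightarrow>\<^sub>M borel" and R: "R \<in> borel \<rightarrow>\<^sub>M borel" and TR: "T \<in> D \<rightarrow> E" "R \<in> E \<rightarrow> D"
    "\<And>u. u \<in> D \<Longrightarrow> R (T u) = u" "\<And>v. v \<in> E \<Longrightarrow> T (R v) = v"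
    using iso by (auto simp: borel_iso_on_def)
  note [measurable] = T R D(1) E(1)
  note [measurable_cong] = \<mu>(2) \<nu>(2)
  obtain Z e d where Z[measurable]: "Z \<in> sets borel" and ZW: "Z \<subseteq> W" and Zn: "Z \<in> null_sets \<mu>" "Z \<in> null_sets \<nu>"
    and ed: "borel_embedding Z e d"
    by (rule ex_null_borel_embedding[OF W \<mu> \<nu>]) blast
  have Wm[measurable]: "W \<in> sets borel" using W by simp
  define D' where "D' = {u \<in> D. u \<notin> Z \<and> T u \<notin> Z}"
  define E' where "E' = {v \<in> E. v \<notin> Z \<and> R v \<notin> Z}"
  have D'm[measurable]: "D' \<in> sets borel" unfolding D'_def by measurable
  have E'm[measurable]: "E' \<in> sets borel" unfolding E'_def by measurable
  have TD: "T \<in> D' \<rightarrow> E'" "R \<in> E' \<rightarrow> D'" using TR by (auto simp: D'_def E'_def)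
  have TRid: "\<And>u. u \<in> D' \<Longrightarrow> R (T u) = u" "\<And>v. v \<in> E' \<Longrightarrow> T (R v) = v"
    using TR by (auto simp: D'_def E'_def)
  have "AE v in distr \<mu> borel T. v \<notin> Z" unfolding distr using Zn(2) by (rule AE_not_in)
  then have "AE u in \<mu>. T u \<notin> Z" by (subst (asm) AE_distr_iff) auto
  with D(3) AE_not_in[OF Zn(1)] have AE_D': "AE u in \<mu>. u \<in> D'"
    by eventually_elim (simp add: D'_def)
  obtain F G where FGiso: "borel_iso_on (W - D') (W - E') F G"
  proof (rule borel_hilbert_hotel[OF _ _ _ _ ed, of "W - D'" "W - E'"])
    show "W - D' \<in> sets borel" "W - E' \<in> sets borel" by auto
    show "Z \<subseteq> W - D'" "Z \<subseteq> W - E'" using ZW by (auto simp: D'_def E'_def)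
  qed
  then have FG[measurable]: "F \<in> borel \<rightarrow>\<^sub>M borel" "G \<in> borel \<rightarrow>\<^sub>M borel"
    and FG': "F \<in> W - D' \<rightarrow> W - E'" "G \<in> W - E' \<rightarrow> W - D'"
    "\<And>x. x \<in> W - D' \<Longrightarrow> G (F x) = x" "\<And>y. y \<in> W - E' \<Longrightarrow> F (G y) = y"
    by (auto simp: borel_iso_on_def)
  have sub: "D' \<subseteq> W" "E' \<subseteq> W" using D E by (auto simp: D'_def E'_def)
  define S where "S u = (if u \<in> D' then T u else F u)" for u
  define S' where "S' v = (if v \<in> E' then R v else G v)" for v
  have "borel_iso_on W W S S'"
    unfolding borel_iso_on_def
  proof (intro conjI ballI)
    show "S \<in> borel \<rightarrow>\<^sub>M borel" unfolding S_def by measurable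
    show "S' \<in> borel \<rightarrow>\<^sub>M borel" unfolding S'_def by measurable
    show "S \<in> W \<rightarrow> W" "S' \<in> W \<rightarrow> W"
      using TD FG'(1,2) sub by (auto simp: S_def S'_def Pi_iff)
    show "S' (S u) = u" if "u \<in> W" for u
      using TD(1) FG'(1,3) TRid(1) that by (auto simp: S_def S'_def Pi_iff)
    show "S (S' v) = v" if "v \<in> W" for v
      using TD(2) FG'(2,4) TRid(2) that by (auto simp: S_def S'_def Pi_iff)
  qed
  moreover have "AE u in \<mu>. S u = T u" using AE_D' by eventually_elim (simp add: S_def)
  ultimately show ?thesis by (rule that)
qed

section \<open>Conjugation with respect to a bilinear form\<close>

locale bilinear_conjugate =
  fixes A :: "'a::euclidean_space \<Rightarrow> 'a" and K :: "'a set"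
  assumes linear_A: "linear A" and self_adjoint: "\<And>u v. u \<bullet> A v = v \<bullet> A u" and inj_A: "inj A"
    and compact_K: "compact K" and nonempty_K: "K \<noteq> {}"
begin

definition conjugate :: "('a \<Rightarrow> real) \<Rightarrow> 'a \<Rightarrow> real" where
  "conjugate f u = (SUP v\<in>K. u \<bullet> A v - f v)"

definition maximizer :: "('a \<Rightarrow> real) \<Rightarrow> 'a \<Rightarrow> 'a \<Rightarrow> bool" where
  "maximizer f u v \<longleftrightarrow> v \<in> K \<and> conjugate f u = u \<bullet> A v - f v"

lemma continuous_A: "continuous_on S A"
  using linear_A by (simp add: linear_continuous_on linear_linear)

lemma bdd_above_conjugate:
  assumes "continuous_on K f"
  shows "bdd_above ((\<lambda>v. u \<bullet> A v - f v) ` K)"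
  by (intro bounded_imp_bdd_above compact_imp_bounded compact_continuous_image compact_K
      continuous_intros continuous_A assms)

lemma conjugate_upper:
  assumes "continuous_on K f" "v \<in> K"
  shows "u \<bullet> A v - f v \<le> conjugate f u"
  unfolding conjugate_def using assms by (intro cSUP_upper bdd_above_conjugate)

lemma conjugate_least:
  assumes "\<And>v. v \<in> K \<Longrightarrow> u \<bullet> A v - f v \<le> c"
  shows "conjugate f u \<le> c"
  unfolding conjugate_def using assms nonempty_K by (intro cSUP_least)

lemma ex_maximizer:
  assumes "continuous_on K f"
  shows "\<exists>v. maximizer f u v"
proof -
  obtain v where v: "v \<in> K" "\<forall>w\<in>K. u \<bullet> A w - f w \<le> u \<bullet> A v - f v"
    using continuous_attains_sup[OF compact_K nonempty_K
        continuous_on_diff[OF continuous_on_inner[OF continuous_on_const continuous_A] assms]]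
    by blast
  then have "conjugate f u = u \<bullet> A v - f v"
    by (intro antisym conjugate_least conjugate_upper assms) auto
  with v show ?thesis unfolding maximizer_def by blast
qed

lemma conjugate_sup_dist:
  assumes "continuous_on K f" "continuous_on K g" "\<And>v. v \<in> K \<Longrightarrow> g v \<le> f v + e"
  shows "conjugate f u \<le> conjugate g u + e"
proof (rule conjugate_least)
  fix v assume "v \<in> K"
  then show "u \<bullet> A v - f v \<le> conjugate g u + e"
    using conjugate_upper[OF assms(2), of v u] assms(3)[of v] by linarith
qed

definition lip :: real where
  "lip = (SUP v\<in>K. norm (A v))"

lemma norm_A_le: "v \<in> K \<Longrightarrow> norm (A v) \<le> lip"
  unfolding lip_def
  by (intro cSUP_upper bounded_imp_bdd_above compact_imp_bounded compact_continuous_image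
      compact_K continuous_intros continuous_A)

lemma lip_nonneg: "0 \<le> lip"
  using nonempty_K norm_A_le norm_ge_zero order_trans by (metis ex_in_conv)

lemma conjugate_lipschitz:
  assumes "continuous_on K f"
  shows "\<bar>conjugate f u - conjugate f w\<bar> \<le> lip * norm (u - w)"
proof -
  have *: "conjugate f u \<le> conjugate f w + lip * norm (u - w)" for u w
  proof (rule conjugate_least)
    fix v assume v: "v \<in> K"
    have "(u - w) \<bullet> A v \<le> norm (u - w) * norm (A v)"
      by (rule norm_cauchy_schwarz)
    also have "\<dots> \<le> norm (u - w) * lip"
      using norm_A_le[OF v] by (simp add: mult_left_mono)
    finally show "u \<bullet> A v - f v \<le> conjugate f w + lip * norm (u - w)"
      using conjugate_upper[OF assms v, of w] by (simp add: inner_diff_left mult.commute)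
  qed
  show ?thesis using *[of u w] *[of w u] by (simp add: norm_minus_commute abs_le_iff)
qed

lemma continuous_conjugate:
  assumes "continuous_on K f"
  shows "continuous_on S (conjugate f)"
proof -
  have "lip-lipschitz_on UNIV (conjugate f)"
    using conjugate_lipschitz[OF assms] lip_nonneg
    by (intro lipschitz_onI) (auto simp: dist_norm)
  then show ?thesis
    using lipschitz_on_continuous_on continuous_on_subset by blast
qed

lemma biconjugate_le:
  assumes "continuous_on K f" "v \<in> K"
  shows "conjugate (conjugate f) v \<le> f v"
proof (rule conjugate_least)
  fix u assume "u \<in> K"
  show "v \<bullet> A u - conjugate f u \<le> f v"
    using conjugate_upper[OF assms, of u] self_adjoint[of u v] by linarith
qed

lemma triconjugate:
  assumes f: "continuous_on K f" and u: "u \<in> K"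
  shows "conjugate (conjugate (conjugate f)) u = conjugate f u"
proof (rule antisym)
  show "conjugate (conjugate (conjugate f)) u \<le> conjugate f u"
    by (intro biconjugate_le continuous_conjugate f u)
  show "conjugate f u \<le> conjugate (conjugate (conjugate f)) u"
    using conjugate_sup_dist[OF f continuous_conjugate[OF continuous_conjugate[OF f]], of 0 u]
      biconjugate_le[OF f] by simp
qed

lemma conjugate_second_difference:
  assumes f: "continuous_on K f" and "maximizer f u v" "maximizer f u w"
  shows "s * (b \<bullet> A v - b \<bullet> A w) \<le> conjugate f (u + s *\<^sub>R b) + conjugate f (u - s *\<^sub>R b) - 2 * conjugate f u"
  using assms(2,3) conjugate_upper[OF f, of v "u + s *\<^sub>R b"] conjugate_upper[OF f, of w "u - s *\<^sub>R b"]
  unfolding maximizer_def by (simp add: inner_add_left inner_diff_left algebra_simps)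

lemma conjugate_midpoint_convex:
  assumes "continuous_on K f"
  shows "0 \<le> conjugate f (u + s *\<^sub>R b) + conjugate f (u - s *\<^sub>R b) - 2 * conjugate f u"
  using ex_maximizer[OF assms, of u] conjugate_second_difference[OF assms, of u _ _ s b] by force

end

lemma lborel_integral_translate:
  fixes f :: "'a::euclidean_space \<Rightarrow> real"
  assumes "f \<in> borel_measurable borel"
  shows "(\<integral>x. f (c + x) \<partial>lborel) = (\<integral>x. f x \<partial>lborel)"
proof -
  have "(\<integral>x. f x \<partial>lborel) = (\<integral>x. f x \<partial>distr lborel borel ((+) c))"
    by (simp add: lborel_distr_plus)
  also have "\<dots> = (\<integral>x. f (c + x) \<partial>lborel)"
    using assms by (subst integral_distr) auto
  finally show ?thesis by simp
qed

lemma integrable_lborel_continuous_ball: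
  fixes f :: "'a::euclidean_space \<Rightarrow> real"
  assumes "continuous_on UNIV f" "\<And>x. r < norm x \<Longrightarrow> f x = 0"
  shows "integrable lborel f"
proof -
  have "integrable lborel (\<lambda>x. indicator (cball 0 r) x *\<^sub>R f x)"
    by (rule borel_integrable_compact) (auto intro: continuous_on_subset[OF assms(1)])
  also have "(\<lambda>x. indicator (cball 0 r) x *\<^sub>R f x) = f"
    using assms(2) by (auto simp: indicator_def fun_eq_iff)
  finally show ?thesis .
qed

context bilinear_conjugate
begin

text \<open>Two maximizers whose images under \<open>A\<close> differ by \<open>d\<close> in direction \<open>b\<close> make the second
  difference of the conjugate at scale \<open>s\<close> at least \<open>d s\<close>.  Moving the shift from the integrand to a
  compactly supported Lipschitz weight shows that second differences have integrals of order \<open>s\<^sup>2\<close>.\<close>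

lemma null_distinct_slopes:
  assumes f: "continuous_on K f" and d: "0 < d" and b: "norm b = 1"
  defines "F \<equiv> \<lambda>n u. conjugate f (u + inverse (real (Suc n)) *\<^sub>R b)
      + conjugate f (u - inverse (real (Suc n)) *\<^sub>R b) - 2 * conjugate f u"
  shows "{u. \<forall>n. d * inverse (real (Suc n)) \<le> F n u} \<in> null_sets lborel" (is "?B \<in> _")
proof -
  define c where "c = conjugate f"
  have c': "continuous_on S (\<lambda>x. c (g x))" if "continuous_on S g" for S and g :: "'a \<Rightarrow> 'a"
    using continuous_conjugate[OF f, of UNIV] that unfolding c_def
    by (auto intro: continuous_on_compose2)
  have clip: "\<bar>c u - c w\<bar> \<le> lip * norm (u - w)" for u w
    unfolding c_def by (rule conjugate_lipschitz[OF f])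
  have Fc: "F n u = c (u + inverse (real (Suc n)) *\<^sub>R b) + c (u - inverse (real (Suc n)) *\<^sub>R b) - 2 * c u"
    for n u unfolding F_def c_def ..
  have Fcont: "continuous_on UNIV (F n)" for n
    unfolding Fc by (intro continuous_intros c')
  have "closed (\<Inter>n. {u. d * inverse (real (Suc n)) \<le> F n u})"
    by (intro closed_INT ballI closed_Collect_le continuous_intros Fcont)
  moreover have "(\<Inter>n. {u. d * inverse (real (Suc n)) \<le> F n u}) = ?B" by auto
  ultimately have Bm[measurable]: "?B \<in> sets borel" by auto
  have "?B \<inter> ball 0 (real m) \<in> null_sets lborel" for m :: nat
  proof -
    define w :: "'a \<Rightarrow> real" where "w u = max 0 (real m - norm u)" for u
    have w_cont: "continuous_on S (\<lambda>x. w (g x))" if "continuous_on S g" for S and g :: "'a \<Rightarrow> 'a"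
      unfolding w_def by (intro continuous_intros that)
    have w0: "w u = 0" if "real m + 1 < norm u + 1" for u using that by (simp add: w_def)
    have wnn: "0 \<le> w u" for u by (simp add: w_def)
    have w_int: "integrable lborel w"
      by (rule integrable_lborel_continuous_ball[of _ m]) (use w_cont[of UNIV "\<lambda>x. x"] w0 in auto)
    define C where "C = lip * measure lborel (cball (0::'a) (real m + 1))"
    have bound: "(\<integral>u. w u * F n u \<partial>lborel) \<le> C * (inverse (real (Suc n)))\<^sup>2" for n
    proof -
      define s where "s = inverse (real (Suc n))"
      have s: "0 \<le> s" "s \<le> 1" unfolding s_def by (auto simp: field_simps)
      define g where "g u = c (u + s *\<^sub>R b) - c u" for u
      have g_cont: "continuous_on UNIV g" unfolding g_def by (intro continuous_intros c')
      have g_cont': "continuous_on UNIV (\<lambda>u. g (u - s *\<^sub>R b))"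
        unfolding g_def by (intro continuous_intros c')
      have g_bd: "\<bar>g u\<bar> \<le> lip * s" for u
        unfolding g_def using clip[of "u + s *\<^sub>R b" u] b s by simp
      have Fg: "F n u = g u - g (u - s *\<^sub>R b)" for u
        unfolding Fc g_def s_def by simp
      have i1: "integrable lborel (\<lambda>u. w u * g u)"
        by (rule integrable_lborel_continuous_ball[of _ m])
          (use w0 in \<open>auto intro!: continuous_intros w_cont g_cont\<close>)
      have i2: "integrable lborel (\<lambda>u. w u * g (u - s *\<^sub>R b))"
        by (rule integrable_lborel_continuous_ball[of _ m])
          (use w0 in \<open>auto intro!: continuous_intros w_cont g_cont'\<close>)
      have w0': "w (s *\<^sub>R b + u) = 0" if "real m + 1 < norm u" for u
      proof (rule w0)
        have "norm u \<le> norm (s *\<^sub>R b + u) + norm (s *\<^sub>R b)"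
          using norm_triangle_ineq4[of "s *\<^sub>R b + u" "s *\<^sub>R b"] by simp
        moreover have "norm (s *\<^sub>R b) \<le> 1" using b s by simp
        ultimately show "real m + 1 < norm (s *\<^sub>R b + u) + 1" using that by linarith
      qed
      have i3: "integrable lborel (\<lambda>u. w (s *\<^sub>R b + u) * g u)"
        by (rule integrable_lborel_continuous_ball[of _ "m + 1"])
          (use w0' in \<open>auto intro!: continuous_intros w_cont g_cont\<close>)
      have "(\<integral>u. w u * g (u - s *\<^sub>R b) \<partial>lborel) = (\<integral>u. w (s *\<^sub>R b + u) * g u \<partial>lborel)"
        using lborel_integral_translate[of "\<lambda>u. w u * g (u - s *\<^sub>R b)" "s *\<^sub>R b",
            OF borel_measurable_continuous_onI[OF continuous_on_mult[OF w_cont[OF continuous_on_id] g_cont']]]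
        by (simp add: id_def)
      then have "(\<integral>u. w u * F n u \<partial>lborel) = (\<integral>u. w u * g u - w (s *\<^sub>R b + u) * g u \<partial>lborel)"
        unfolding Fg using i1 i2 i3 by (simp add: right_diff_distrib)
      also have "\<dots> \<le> (\<integral>u. lip * s\<^sup>2 * indicator (cball (0::'a) (real m + 1)) u \<partial>lborel)"
      proof (rule integral_mono)
        show "integrable lborel (\<lambda>u. w u * g u - w (s *\<^sub>R b + u) * g u)"
          using i1 i3 by simp
        show "integrable lborel (\<lambda>u. lip * s\<^sup>2 * indicator (cball (0::'a) (real m + 1)) u)"
          using emeasure_lborel_cball_finite[of "0::'a" "real m + 1"]
          by (intro integrable_mult_right integrable_real_indicator) auto
        fix u :: 'a
        show "w u * g u - w (s *\<^sub>R b + u) * g u \<le> lip * s\<^sup>2 * indicator (cball (0::'a) (real m + 1)) u"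
        proof (cases "norm u \<le> real m + 1")
          case True
          have "\<bar>w u - w (s *\<^sub>R b + u)\<bar> \<le> norm (s *\<^sub>R b)"
          proof -
            have "norm (s *\<^sub>R b + u) \<le> norm (s *\<^sub>R b) + norm u" by (rule norm_triangle_ineq)
            moreover have "norm u \<le> norm (s *\<^sub>R b + u) + norm (s *\<^sub>R b)"
              using norm_triangle_ineq4[of "s *\<^sub>R b + u" "s *\<^sub>R b"] by simp
            ultimately show ?thesis unfolding w_def by (auto simp: max_def)
          qed
          then have "\<bar>w u - w (s *\<^sub>R b + u)\<bar> \<le> s" using b s by simp
          then have "\<bar>(w u - w (s *\<^sub>R b + u)) * g u\<bar> \<le> s * (lip * s)"
            unfolding abs_mult using g_bd[of u] s lip_nonneg by (intro mult_mono) auto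
          then have "(w u - w (s *\<^sub>R b + u)) * g u \<le> lip * s\<^sup>2"
            by (auto simp: power2_eq_square mult_ac dest: abs_le_D1)
          then show ?thesis using True by (simp add: left_diff_distrib)
        next
          case False
          then show ?thesis using w0[of u] w0'[of u] by simp
        qed
      qed
      also have "\<dots> = C * s\<^sup>2" unfolding C_def by simp
      finally show ?thesis unfolding s_def .
    qed
    have Bi: "integrable lborel (\<lambda>u. w u * indicator ?B u)"
      using w_int Bm by (intro integrable_real_mult_indicator) simp_all
    have Fi: "integrable lborel (\<lambda>u. w u * F n u)" for n
      by (rule integrable_lborel_continuous_ball[of _ m])
        (use w0 in \<open>auto intro!: continuous_intros w_cont Fcont\<close>)
    define I where "I = (\<integral>u. w u * indicator ?B u \<partial>lborel)"
    have "d * I \<le> C * inverse (real (Suc n))" for n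
    proof -
      have "d * inverse (real (Suc n)) * I = (\<integral>u. d * inverse (real (Suc n)) * (w u * indicator ?B u) \<partial>lborel)"
        unfolding I_def by simp
      also have "\<dots> \<le> (\<integral>u. w u * F n u \<partial>lborel)"
      proof (rule integral_mono)
        fix u :: 'a
        show "d * inverse (real (Suc n)) * (w u * indicator ?B u) \<le> w u * F n u"
        proof (cases "u \<in> ?B")
          case True
          then have "d * inverse (real (Suc n)) \<le> F n u" by blast
          then have "w u * (d * inverse (real (Suc n))) \<le> w u * F n u"
            using wnn by (intro mult_left_mono)
          with True show ?thesis by (simp add: mult.commute)
        next
          case False
          have "0 \<le> F n u" unfolding F_def by (rule conjugate_midpoint_convex[OF f])
          with False wnn show ?thesis by simp
        qed
      qed (use Bi Fi in auto)
      also note bound[of n]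
      finally have "inverse (real (Suc n)) * (d * I) \<le> inverse (real (Suc n)) * (C * inverse (real (Suc n)))"
        by (simp add: power2_eq_square ac_simps)
      then show ?thesis by (simp add: field_simps del: of_nat_Suc)
    qed
    moreover have "(\<lambda>n. C * inverse (real (Suc n))) \<longlonglongrightarrow> C * 0"
      by (intro tendsto_intros LIMSEQ_inverse_real_of_nat)
    ultimately have "d * I \<le> C * 0"
      by (intro LIMSEQ_le_const) auto
    then have "I \<le> 0" using d by (simp add: mult_le_0_iff)
    moreover have "0 \<le> I" unfolding I_def using wnn by (intro integral_nonneg_AE) auto
    ultimately have "(\<integral>u. w u * indicator ?B u \<partial>lborel) = 0" unfolding I_def by simp
    then have ae: "AE u in lborel. w u * indicator ?B u = 0"
      using integral_nonneg_eq_0_iff_AE[OF Bi] wnn by simp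
    have "AE u in lborel. u \<notin> ?B \<inter> ball 0 (real m)"
      using ae by eventually_elim (auto simp: w_def indicator_def max_def split: if_splits)
    then show ?thesis
      using Bm by (subst (asm) AE_iff_null_sets[symmetric]) (simp_all del: of_nat_Suc)
  qed
  then have "(\<Union>m. ?B \<inter> ball 0 (real m)) \<in> null_sets lborel" by (rule null_sets_UN)
  moreover have "(\<Union>m. ?B \<inter> ball 0 (real m)) = ?B"
  proof -
    have "\<exists>m. u \<in> ball 0 (real m)" for u :: 'a using reals_Archimedean2[of "norm u"] by auto
    then show ?thesis by blast
  qed
  ultimately show ?thesis by simp
qed

lemma AE_unique_maximizer:
  assumes f: "continuous_on K f"
  shows "AE u in lborel. \<forall>v w. maximizer f u v \<and> maximizer f u w \<longrightarrow> v = w"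
proof -
  define F where "F b n u = conjugate f (u + inverse (real (Suc n)) *\<^sub>R b)
      + conjugate f (u - inverse (real (Suc n)) *\<^sub>R b) - 2 * conjugate f u" for b n u
  have "AE u in lborel. u \<notin> {u. \<forall>n. inverse (real (Suc k)) * inverse (real (Suc n)) \<le> F b n u}"
    if "b \<in> Basis" for k b
    unfolding F_def using that by (intro AE_not_in null_distinct_slopes[OF f]) auto
  then have "AE u in lborel. \<forall>b\<in>Basis. \<forall>k. u \<notin> {u. \<forall>n. inverse (real (Suc k)) * inverse (real (Suc n)) \<le> F b n u}"
    by (intro AE_finite_allI finite_Basis) (simp only: AE_all_countable, blast)
  then show ?thesis
  proof eventually_elim
    case (elim u)
    have *: "b \<bullet> A v \<le> b \<bullet> A w" if "maximizer f u v" "maximizer f u w" "b \<in> Basis" for v w b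
    proof (rule ccontr)
      assume "\<not> ?thesis"
      then obtain k where k: "inverse (real (Suc k)) < b \<bullet> A v - b \<bullet> A w"
        using reals_Archimedean[of "b \<bullet> A v - b \<bullet> A w"] by auto
      have "inverse (real (Suc k)) * inverse (real (Suc n)) \<le> F b n u" for n
      proof -
        have "inverse (real (Suc k)) * inverse (real (Suc n)) \<le> inverse (real (Suc n)) * (b \<bullet> A v - b \<bullet> A w)"
          using k by (simp add: mult.commute[of _ "inverse (real (Suc n))"])
        also have "\<dots> \<le> F b n u"
          unfolding F_def by (rule conjugate_second_difference[OF f that(1,2)])
        finally show ?thesis .
      qed
      with elim that(3) show False by blast
    qed
    show ?case
    proof (intro allI impI)
      fix v w assume vw: "maximizer f u v \<and> maximizer f u w"
      have "A v = A w"
      proof (rule euclidean_eqI)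
        fix b :: 'a assume "b \<in> Basis"
        then show "A v \<bullet> b = A w \<bullet> b"
          using *[of v w b] *[of w v b] vw by (simp add: inner_commute)
      qed
      then show "v = w" using inj_A by (auto dest: injD)
    qed
  qed
qed

end

section \<open>The dual problem\<close>

lemma measure_eqI_continuous:
  fixes P Q :: "'a::euclidean_space measure"
  assumes P: "finite_measure P" "sets P = sets borel" and Q: "finite_measure Q" "sets Q = sets borel"
    and eq: "\<And>h :: 'a \<Rightarrow> real. continuous_on UNIV h \<Longrightarrow> (\<And>x. 0 \<le> h x \<and> h x \<le> 1) \<Longrightarrow>
      (\<integral>x. h x \<partial>P) = (\<integral>x. h x \<partial>Q)"
  shows "P = Q"
proof -
  interpret P: finite_measure P by fact
  interpret Q: finite_measure Q by fact
  have closed_eq: "emeasure P C = emeasure Q C" if C: "closed C" for C :: "'a set"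
  proof (cases "C = {}")
    case False
    define h where "h n x = max 0 (1 - real n * infdist x C)" for n x
    have h_cont: "continuous_on UNIV (h n)" for n
      unfolding h_def by (intro continuous_intros)
    have h_bd: "0 \<le> h n x \<and> h n x \<le> 1" for n x
      unfolding h_def using infdist_nonneg[of x C] by auto
    have h_lim: "(\<lambda>n. h n x) \<longlonglongrightarrow> indicator C x" for x
    proof (cases "x \<in> C")
      case True
      then show ?thesis by (simp add: h_def)
    next
      case notin: False
      then have pos: "0 < infdist x C"
        using C False in_closed_iff_infdist_zero[of C x] infdist_nonneg[of x C] by (simp add: less_le)
      obtain N :: nat where N: "1 / infdist x C < real N" using reals_Archimedean2 by blast
      have "h n x = 0" if "n \<ge> N" for n
      proof -
        have "1 < real N * infdist x C" using N pos by (simp add: field_simps)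
        also have "\<dots> \<le> real n * infdist x C" using that pos by simp
        finally show ?thesis by (simp add: h_def)
      qed
      then have "\<forall>\<^sub>F n in sequentially. h n x = indicator C x"
        using notin unfolding eventually_sequentially by (intro exI[of _ N]) simp
      then show ?thesis by (rule tendsto_eventually)
    qed
    have lim: "(\<lambda>n. \<integral>x. h n x \<partial>R) \<longlonglongrightarrow> measure R C" if R: "finite_measure R" "sets R = sets borel" for R
    proof -
      interpret R: finite_measure R by fact
      have "(\<lambda>n. \<integral>x. h n x \<partial>R) \<longlonglongrightarrow> (\<integral>x. indicator C x \<partial>R)"
      proof (rule integral_dominated_convergence[where w="\<lambda>_. 1"])
        show "h n \<in> borel_measurable R" for n
          using borel_measurable_continuous_onI[OF h_cont] R by (simp cong: measurable_cong_sets)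
        show "indicat_real C \<in> borel_measurable R"
          using C R by (intro borel_measurable_indicator) auto
      qed (use h_lim h_bd in auto)
      then show ?thesis using C R by (simp add: sets_eq_imp_space_eq[OF R(2)])
    qed
    have "measure P C = measure Q C"
      using lim[OF P] lim[OF Q] eq[OF h_cont h_bd] by (simp add: LIMSEQ_unique)
    then show ?thesis by (simp add: P.emeasure_eq_measure Q.emeasure_eq_measure)
  qed simp
  show ?thesis
  proof (rule measure_eqI_generator_eq[where E="Collect closed" and \<Omega>=UNIV and A="\<lambda>_. UNIV"])
    show "Int_stable (Collect closed :: 'a set set)" by (auto simp: Int_stable_def)
  qed (use P Q closed_eq in \<open>auto simp: borel_eq_closed\<close>)
qed

locale transport_pair = bilinear_conjugate A K
  for A :: "'a::euclidean_space \<Rightarrow> 'a" and K +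
  fixes \<mu> \<nu> :: "'a measure"
  assumes prob_\<mu>: "prob_space \<mu>" and prob_\<nu>: "prob_space \<nu>"
    and sets_\<mu>[measurable_cong]: "sets \<mu> = sets borel"
    and sets_\<nu>[measurable_cong]: "sets \<nu> = sets borel"
    and AE_\<mu>: "AE u in \<mu>. u \<in> K" and AE_\<nu>: "AE v in \<nu>. v \<in> K"
begin

sublocale \<mu>: prob_space \<mu> by (rule prob_\<mu>)
sublocale \<nu>: prob_space \<nu> by (rule prob_\<nu>)

lemma continuous_imp_bounded_on_K:
  assumes "continuous_on K f"
  obtains B where "0 \<le> B" "\<And>v. v \<in> K \<Longrightarrow> \<bar>f v :: real\<bar> \<le> B"
proof -
  have "bounded (f ` K)"
    by (intro compact_imp_bounded compact_continuous_image assms compact_K)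
  then show ?thesis using that unfolding bounded_pos by (metis image_eqI less_imp_le real_norm_def)
qed

lemma borel_of_continuous:
  fixes f :: "'a \<Rightarrow> real"
  assumes "continuous_on UNIV f"
  shows "f \<in> borel_measurable \<mu>" "f \<in> borel_measurable \<nu>"
  using borel_measurable_continuous_onI[OF assms] by simp_all

lemma integrable_continuous:
  fixes f :: "'a \<Rightarrow> real"
  assumes "continuous_on UNIV f"
  shows "integrable \<mu> f" "integrable \<nu> f"
proof -
  obtain B where B: "\<And>v. v \<in> K \<Longrightarrow> \<bar>f v\<bar> \<le> B"
    using continuous_imp_bounded_on_K continuous_on_subset[OF assms] by blast
  show "integrable \<mu> f"
    using AE_\<mu> B borel_of_continuous[OF assms] by (intro \<mu>.integrable_const_bound[of _ B]) auto
  show "integrable \<nu> f"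
    using AE_\<nu> B borel_of_continuous[OF assms] by (intro \<nu>.integrable_const_bound[of _ B]) auto
qed

definition dual :: "('a \<Rightarrow> real) \<Rightarrow> real" where
  "dual f = (\<integral>u. conjugate f u \<partial>\<mu>) + (\<integral>v. f v \<partial>\<nu>)"

lemma dual_le:
  assumes f: "continuous_on UNIV f" and g: "continuous_on UNIV g"
    and conj: "\<And>u. u \<in> K \<Longrightarrow> conjugate f u \<le> conjugate g u + c"
    and le: "\<And>v. v \<in> K \<Longrightarrow> f v \<le> g v + d"
  shows "dual f \<le> dual g + (c + d)"
proof -
  have fK: "continuous_on K f" "continuous_on K g"
    using f g continuous_on_subset by blast+
  note int = integrable_continuous[OF continuous_conjugate[OF fK(1)]]
    integrable_continuous[OF continuous_conjugate[OF fK(2)]]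
    integrable_continuous[OF f] integrable_continuous[OF g]
  have "(\<integral>u. conjugate f u \<partial>\<mu>) \<le> (\<integral>u. conjugate g u + c \<partial>\<mu>)"
    by (rule integral_mono_AE) (use int AE_\<mu> conj in auto)
  moreover have "(\<integral>v. f v \<partial>\<nu>) \<le> (\<integral>v. g v + d \<partial>\<nu>)"
    by (rule integral_mono_AE) (use int AE_\<nu> le in auto)
  ultimately show ?thesis
    unfolding dual_def using int by (simp add: \<mu>.prob_space \<nu>.prob_space)
qed

lemma dual_bounded_below: "\<exists>c. \<forall>f. continuous_on UNIV f \<longrightarrow> c \<le> dual f"
proof -
  obtain B where B: "0 \<le> B" "\<And>v. v \<in> K \<Longrightarrow> norm v \<le> B"
    using compact_imp_bounded[OF compact_K] unfolding bounded_pos by (auto intro: less_imp_le)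
  have "- (B * lip) \<le> dual f" if f: "continuous_on UNIV f" for f
  proof -
    have fK: "continuous_on K f" using f continuous_on_subset by blast
    note int = integrable_continuous[OF continuous_conjugate[OF fK]] integrable_continuous[OF f]
    have *: "- (B * lip) \<le> conjugate f u + f v" if "u \<in> K" "v \<in> K" for u v
    proof -
      have "\<bar>u \<bullet> A v\<bar> \<le> norm u * norm (A v)" by (rule Cauchy_Schwarz_ineq2)
      also have "\<dots> \<le> B * lip" using B norm_A_le that by (intro mult_mono) auto
      finally show ?thesis using conjugate_upper[OF fK that(2), of u] by linarith
    qed
    have "- (B * lip) - f v \<le> (\<integral>u. conjugate f u \<partial>\<mu>)" if "v \<in> K" for v
    proof -
      have "(\<integral>u. - (B * lip) - f v \<partial>\<mu>) \<le> (\<integral>u. conjugate f u \<partial>\<mu>)"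
      proof (rule integral_mono_AE)
        show "AE u in \<mu>. - (B * lip) - f v \<le> conjugate f u"
          using AE_\<mu> by eventually_elim (use *[OF _ that] in \<open>simp add: algebra_simps\<close>)
      qed (use int in auto)
      then show ?thesis by (simp add: \<mu>.prob_space)
    qed
    then have ae: "AE v in \<nu>. - (B * lip) - (\<integral>u. conjugate f u \<partial>\<mu>) \<le> f v"
      using AE_\<nu> by (auto simp: algebra_simps)
    have "(\<integral>v. - (B * lip) - (\<integral>u. conjugate f u \<partial>\<mu>) \<partial>\<nu>) \<le> (\<integral>v. f v \<partial>\<nu>)"
      by (rule integral_mono_AE) (use int ae in auto)
    then show ?thesis unfolding dual_def by (simp add: \<nu>.prob_space)
  qed
  then show ?thesis by blast
qed

text \<open>Replacing \<open>f\<close> by its biconjugate does not increase the dual value and produces a function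
  with a Lipschitz constant that depends on \<open>K\<close> only, so that Arzela-Ascoli applies.\<close>

lemma ex_dual_minimizer:
  obtains g where "continuous_on K g"
    "\<And>h. continuous_on UNIV h \<Longrightarrow> dual (conjugate (conjugate g)) \<le> dual h"
proof -
  define m where "m = (INF f\<in>{f. continuous_on UNIV f}. dual f)"
  have bdd: "bdd_below (dual ` {f. continuous_on UNIV f})"
    using dual_bounded_below by (auto simp: bdd_below_def)
  have m_le: "m \<le> dual h" if "continuous_on UNIV h" for h
    unfolding m_def using that by (intro cINF_lower bdd) auto
  have "\<exists>f. continuous_on UNIV f \<and> dual f < m + inverse (real (Suc n))" for n
  proof -
    have "m < m + inverse (real (Suc n))" by simp
    then show ?thesis
      unfolding m_def using bdd
      by (subst (asm) cINF_less_iff) (auto intro: exI[of _ "\<lambda>_. 0"] continuous_on_const)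
  qed
  then obtain p where p: "\<And>n. continuous_on UNIV (p n)"
    and dp: "\<And>n. dual (p n) < m + inverse (real (Suc n))"
    by metis
  have pK: "continuous_on K (p n)" for n using p continuous_on_subset by blast
  obtain v0 where v0: "v0 \<in> K" using nonempty_K by auto
  define q where "q n v = conjugate (conjugate (p n)) v - conjugate (conjugate (p n)) v0" for n v
  have q: "continuous_on S (q n)" for S n
    unfolding q_def by (intro continuous_intros continuous_conjugate pK)
  have conj_q: "conjugate (q n) u = conjugate (p n) u + conjugate (conjugate (p n)) v0" if "u \<in> K" for n u
  proof -
    have "conjugate (q n) u \<le> conjugate (conjugate (conjugate (p n))) u + conjugate (conjugate (p n)) v0"
      by (rule conjugate_sup_dist)
        (auto simp: q_def intro!: continuous_conjugate pK continuous_intros)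
    moreover have "conjugate (conjugate (conjugate (p n))) u \<le> conjugate (q n) u + (- conjugate (conjugate (p n)) v0)"
      by (rule conjugate_sup_dist)
        (auto simp: q_def intro!: continuous_conjugate pK continuous_intros)
    ultimately show ?thesis using triconjugate[OF pK that, of n] by linarith
  qed
  have dq: "dual (q n) \<le> dual (p n)" for n
  proof -
    have "dual (q n) \<le> dual (p n) + (conjugate (conjugate (p n)) v0 + - conjugate (conjugate (p n)) v0)"
      by (rule dual_le[OF q p]) (use conj_q biconjugate_le[OF pK] in \<open>auto simp: q_def\<close>)
    then show ?thesis by simp
  qed
  have q_lip: "\<bar>q n u - q n w\<bar> \<le> lip * norm (u - w)" for n u w
    unfolding q_def using conjugate_lipschitz[OF continuous_conjugate[OF pK], of n u w] by simp
  obtain B where B: "\<And>v. v \<in> K \<Longrightarrow> norm (v - v0) \<le> B"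
    using compact_imp_bounded[OF compact_K] unfolding bounded_any_center[of _ v0]
    by (metis dist_norm dist_commute)
  have "norm (q n v) \<le> lip * B" if "v \<in> K" for n v
  proof -
    have "\<bar>q n v - q n v0\<bar> \<le> lip * norm (v - v0)" by (rule q_lip)
    also have "\<dots> \<le> lip * B" using B[OF that] lip_nonneg by (rule mult_left_mono)
    finally show ?thesis by (simp add: q_def)
  qed
  moreover have "\<exists>d>0. \<forall>n y. y \<in> K \<and> norm (x - y) < d \<longrightarrow> norm (q n x - q n y) < e" if "0 < e" for x e
  proof (intro exI[of _ "e / (lip + 1)"] conjI allI impI)
    show "0 < e / (lip + 1)" using that lip_nonneg by (simp add: add_nonneg_pos)
    fix n y assume y: "y \<in> K \<and> norm (x - y) < e / (lip + 1)"
    have "norm (q n x - q n y) \<le> lip * norm (x - y)" using q_lip by simp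
    also have "\<dots> \<le> (lip + 1) * norm (x - y)" by (simp add: distrib_right)
    also have "\<dots> < e" using y lip_nonneg by (simp add: field_simps add_nonneg_pos)
    finally show "norm (q n x - q n y) < e" .
  qed
  ultimately obtain g k where g: "continuous_on K g" and k: "strict_mono (k :: nat \<Rightarrow> nat)"
    and conv: "\<And>e. 0 < e \<Longrightarrow> \<exists>N. \<forall>n x. n \<ge> N \<and> x \<in> K \<longrightarrow> norm (q (k n) x - g x) < e"
    using Arzela_Ascoli[OF compact_K, of q "lip * B"] by blast
  have cg: "continuous_on S (conjugate (conjugate g))" for S
    by (intro continuous_conjugate g)
  have "dual (conjugate (conjugate g)) \<le> m"
  proof (rule field_le_epsilon)
    fix e :: real assume e: "0 < e"
    then obtain N where N: "\<And>n x. n \<ge> N \<Longrightarrow> x \<in> K \<Longrightarrow> norm (q (k n) x - g x) < e / 3"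
      using conv[of "e / 3"] by auto
    obtain N' where N': "inverse (real (Suc N')) < e / 3" using reals_Archimedean[of "e / 3"] e by auto
    define n where "n = max N N'"
    have "inverse (real (Suc (k n))) \<le> inverse (real (Suc N'))"
      using seq_suble[OF k, of n] by (intro le_imp_inverse_le) (auto simp: n_def)
    with N' have small: "inverse (real (Suc (k n))) < e / 3" by linarith
    have close: "\<bar>q (k n) x - g x\<bar> < e / 3" if "x \<in> K" for x
      using N[of n x] that by (simp add: n_def)
    have "dual (conjugate (conjugate g)) \<le> dual (q (k n)) + (e / 3 + e / 3)"
    proof (rule dual_le[OF cg q])
      fix u assume "u \<in> K"
      then have "conjugate (conjugate (conjugate g)) u = conjugate g u" by (rule triconjugate[OF g])
      also have "\<dots> \<le> conjugate (q (k n)) u + e / 3"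
        by (rule conjugate_sup_dist[OF g q]) (use close in \<open>smt (verit)\<close>)
      finally show "conjugate (conjugate (conjugate g)) u \<le> conjugate (q (k n)) u + e / 3" .
    next
      fix v assume v: "v \<in> K"
      show "conjugate (conjugate g) v \<le> q (k n) v + e / 3"
        using biconjugate_le[OF g v] close[OF v] by linarith
    qed
    also have "\<dots> \<le> m + inverse (real (Suc (k n))) + (e / 3 + e / 3)"
      using dq[of "k n"] dp[of "k n"] by linarith
    also have "\<dots> \<le> m + e" using small by linarith
    finally show "dual (conjugate (conjugate g)) \<le> m + e" .
  qed
  with that[OF g] m_le show ?thesis by (meson order_trans)
qed

end

context bilinear_conjugate
begin

lemma conjugate_quotient_bound:
  assumes f: "continuous_on K f" and h: "continuous_on K h" and s: "0 < s"
    and B: "\<And>v. v \<in> K \<Longrightarrow> \<bar>h v\<bar> \<le> B"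
  shows "\<bar>(conjugate (\<lambda>x. f x + s * h x) u - conjugate f u) / s\<bar> \<le> B"
proof -
  have sB: "\<bar>s * h v\<bar> \<le> s * B" if "v \<in> K" for v
    using B[OF that] s by (simp add: abs_mult)
  have fs: "continuous_on K (\<lambda>x. f x + s * h x)" by (intro continuous_intros f h)
  have "conjugate (\<lambda>x. f x + s * h x) u \<le> conjugate f u + s * B"
    by (rule conjugate_sup_dist[OF fs f]) (use sB in \<open>smt (verit)\<close>)
  moreover have "conjugate f u \<le> conjugate (\<lambda>x. f x + s * h x) u + s * B"
    by (rule conjugate_sup_dist[OF f fs]) (use sB in \<open>smt (verit)\<close>)
  ultimately have "\<bar>conjugate (\<lambda>x. f x + s * h x) u - conjugate f u\<bar> \<le> B * s"
    by (simp add: abs_le_iff mult.commute)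
  then show ?thesis using s by (simp add: pos_divide_le_eq)
qed

lemma conjugate_quotient_tendsto:
  fixes s :: "nat \<Rightarrow> real"
  assumes f: "continuous_on K f" and h: "continuous_on K h"
    and s: "\<And>n. 0 < s n" "s \<longlonglongrightarrow> 0"
    and v: "maximizer f u v" and uniq: "\<And>w. maximizer f u w \<Longrightarrow> w = v"
  shows "(\<lambda>n. (conjugate (\<lambda>x. f x + s n * h x) u - conjugate f u) / s n) \<longlonglongrightarrow> - h v"
proof -
  define q where "q n = (conjugate (\<lambda>x. f x + s n * h x) u - conjugate f u) / s n" for n
  have fs: "continuous_on K (\<lambda>x. f x + s n * h x)" for n
    by (intro continuous_intros f h)
  have vK: "v \<in> K" "conjugate f u = u \<bullet> A v - f v" using v by (auto simp: maximizer_def)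
  have lower: "- h v \<le> q n" for n
    using conjugate_upper[OF fs vK(1), of u n] vK(2) s(1)[of n]
    unfolding q_def by (simp add: field_simps)
  define V where "V n = (SOME w. maximizer (\<lambda>x. f x + s n * h x) u w)" for n
  have V: "maximizer (\<lambda>x. f x + s n * h x) u (V n)" for n
    unfolding V_def by (rule someI_ex[OF ex_maximizer[OF fs]])
  have VK: "V n \<in> K" for n using V[of n] by (simp add: maximizer_def)
  have upper: "q n \<le> - h (V n)" for n
    using conjugate_upper[OF f VK[of n], of u] V[of n] s(1)[of n]
    unfolding q_def maximizer_def by (simp add: field_simps)
  have ev: "\<forall>\<^sub>F n in sequentially. - h (V n) < - h v + e" if e: "0 < e" for e
  proof (cases "{w \<in> K. h w \<le> h v - e} = {}")
    case True
    then have "- h (V n) < - h v + e" for n using VK[of n] by force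
    then show ?thesis by simp
  next
    case False
    have "closed {w \<in> K. h w \<le> h v - e}"
      using continuous_closed_preimage[OF h compact_imp_closed[OF compact_K], of "{..h v - e}"]
      by (simp add: Int_def vimage_def)
    then have "compact (K \<inter> {w \<in> K. h w \<le> h v - e})" by (intro compact_Int_closed compact_K)
    moreover have "K \<inter> {w \<in> K. h w \<le> h v - e} = {w \<in> K. h w \<le> h v - e}" by auto
    ultimately have cpt: "compact {w \<in> K. h w \<le> h v - e}" by simp
    have "continuous_on {w \<in> K. h w \<le> h v - e} (\<lambda>w. u \<bullet> A w - f w)"
      by (intro continuous_intros continuous_A continuous_on_subset[OF f]) auto
    from continuous_attains_sup[OF cpt False this] obtain z where z: "z \<in> K" "h z \<le> h v - e"
      and zmax: "\<And>w. w \<in> K \<Longrightarrow> h w \<le> h v - e \<Longrightarrow> u \<bullet> A w - f w \<le> u \<bullet> A z - f z"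
      by blast
    define c where "c = conjugate f u - (u \<bullet> A z - f z)"
    have "c \<noteq> 0"
    proof
      assume "c = 0"
      then have "maximizer f u z" using z by (simp add: c_def maximizer_def)
      then have "z = v" by (rule uniq)
      with z e show False by simp
    qed
    then have c: "0 < c" using conjugate_upper[OF f z(1), of u] by (simp add: c_def)
    have "(h ` K) \<noteq> {} \<and> bounded (h ` K)"
      using compact_imp_bounded[OF compact_continuous_image[OF h compact_K]] nonempty_K by auto
    then obtain B where B: "0 < B" "\<And>w. w \<in> K \<Longrightarrow> \<bar>h w\<bar> \<le> B"
      unfolding bounded_pos by auto
    have "\<forall>\<^sub>F n in sequentially. s n < c / (2 * B)"
      using s(2) c B by (intro order_tendstoD) auto
    then show ?thesis
    proof eventually_elim
      case (elim n)
      show ?case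
      proof (rule ccontr)
        assume "\<not> ?case"
        then have "u \<bullet> A (V n) - f (V n) \<le> u \<bullet> A z - f z"
          using zmax[OF VK, of n] by linarith
        then have "u \<bullet> A (V n) - f (V n) \<le> conjugate f u - c" by (simp add: c_def)
        moreover have "conjugate f u - s n * h v \<le> u \<bullet> A (V n) - f (V n) - s n * h (V n)"
          using conjugate_upper[OF fs vK(1), of u n] V[of n] vK(2) unfolding maximizer_def by simp
        ultimately have "c \<le> s n * (h v - h (V n))" by (simp add: algebra_simps)
        also have "\<dots> \<le> s n * (2 * B)"
          using B(2)[OF vK(1)] B(2)[OF VK, of n] s(1)[of n] by (intro mult_left_mono) auto
        also have "\<dots> < c" using elim B(1) by (simp add: field_simps)
        finally show False by simp
      qed
    qed
  qed
  have "q \<longlonglongrightarrow> - h v"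
  proof (rule order_tendstoI)
    fix a assume "a < - h v"
    then show "\<forall>\<^sub>F n in sequentially. a < q n" using lower
      by (intro always_eventually allI) (blast intro: less_le_trans)
  next
    fix a assume "- h v < a"
    then have "\<forall>\<^sub>F n in sequentially. - h (V n) < - h v + (a + h v)" by (intro ev) simp
    then show "\<forall>\<^sub>F n in sequentially. q n < a"
      by eventually_elim (use upper le_less_trans in fastforce)
  qed
  then show ?thesis unfolding q_def .
qed

lemma ex_maximizer_map:
  assumes f: "continuous_on UNIV f"
  obtains T N where "N \<in> null_sets lborel" "T \<in> borel_measurable borel"
    "\<And>u. u \<notin> N \<Longrightarrow> maximizer f u (T u)"
    "\<And>u w. u \<notin> N \<Longrightarrow> maximizer f u w \<Longrightarrow> w = T u"
proof -
  have fK: "continuous_on K f" using f continuous_on_subset by blast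
  obtain N where N: "N \<in> null_sets lborel"
    and uniq: "\<And>u v w. u \<notin> N \<Longrightarrow> maximizer f u v \<Longrightarrow> maximizer f u w \<Longrightarrow> v = w"
    using AE_unique_maximizer[OF fK] unfolding eventually_ae_filter by (auto simp: subset_iff)
  obtain T0 where T0: "\<And>u. maximizer f u (T0 u)" using ex_maximizer[OF fK] by metis
  have "closed {p. conjugate f (fst p) \<le> fst p \<bullet> A (snd p) - f (snd p)}"
    by (intro closed_Collect_le continuous_intros
        continuous_on_compose2[OF continuous_conjugate[OF fK]]
        continuous_on_compose2[OF continuous_A] continuous_on_compose2[OF f]) auto
  moreover have "(\<lambda>u. (u, T0 u)) ` (- N) =
      ((- N) \<times> K) \<inter> {p. conjugate f (fst p) \<le> fst p \<bullet> A (snd p) - f (snd p)}"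
  proof -
    have "conjugate f u \<le> u \<bullet> A v - f v \<longleftrightarrow> v = T0 u" if "u \<notin> N" "v \<in> K" for u v
      using uniq[OF that(1) T0, of v] conjugate_upper[OF fK that(2), of u] T0[of u] that(2)
      unfolding maximizer_def by auto
    moreover have "T0 u \<in> K" for u using T0 by (simp add: maximizer_def)
    ultimately show ?thesis by auto
  qed
  ultimately have "closedin (top_of_set ((- N) \<times> K)) ((\<lambda>u. (u, T0 u)) ` (- N))"
    by (auto intro: closedin_closed_Int)
  then have "continuous_on (- N) T0"
    using T0 by (subst continuous_closed_graph_eq[OF compact_K]) (auto simp: maximizer_def)
  moreover have "N \<in> sets borel" using N by (auto dest: null_setsD2)
  ultimately have "(\<lambda>u. if u \<in> N then 0 else T0 u) \<in> borel_measurable borel"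
    by (intro borel_measurable_continuous_on_if) auto
  with N show ?thesis
    by (rule that) (use T0 uniq[OF _ _ T0] in auto)
qed

end

context transport_pair
begin

text \<open>The first variation of the dual functional at a minimizer in direction \<open>h\<close> is
  \<open>\<integral>h d\<nu> - \<integral>(h \<circ> T) d\<mu>\<close>.\<close>

lemma distr_maximizer_map:
  assumes f: "continuous_on UNIV f" and min: "\<And>h. continuous_on UNIV h \<Longrightarrow> dual f \<le> dual h"
    and T: "T \<in> borel_measurable borel"
    and Tmax: "AE u in \<mu>. maximizer f u (T u) \<and> (\<forall>w. maximizer f u w \<longrightarrow> w = T u)"
  shows "distr \<mu> borel T = \<nu>"
proof -
  have fK: "continuous_on K f" using f continuous_on_subset by blast
  have T': "T \<in> \<mu> \<rightarrow>\<^sub>M borel" using T by simp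
  define s where "s n = inverse (real (Suc n))" for n
  have s: "0 < s n" "s \<longlonglongrightarrow> 0" for n
    unfolding s_def using LIMSEQ_inverse_real_of_nat by auto
  have var: "(\<integral>u. h (T u) \<partial>\<mu>) \<le> (\<integral>v. h v \<partial>\<nu>)" if h: "continuous_on UNIV h" for h :: "'a \<Rightarrow> real"
  proof -
    have hK: "continuous_on K h" using h continuous_on_subset by blast
    obtain B where B: "0 \<le> B" "\<And>v. v \<in> K \<Longrightarrow> \<bar>h v\<bar> \<le> B"
      using continuous_imp_bounded_on_K[OF hK] by blast
    have fsU: "continuous_on UNIV (\<lambda>x. f x + s n * h x)" for n by (intro continuous_intros f h)
    then have fs: "continuous_on K (\<lambda>x. f x + s n * h x)" for n using continuous_on_subset by blast
    define q where "q n u = (conjugate (\<lambda>x. f x + s n * h x) u - conjugate f u) / s n" for n u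
    have "continuous_on UNIV (q n)" for n
      unfolding q_def using s(1)[of n] by (intro continuous_intros continuous_conjugate fs fK) auto
    note q_int = integrable_continuous(1)[OF this] and q_meas = borel_of_continuous(1)[OF this]
    have "(\<lambda>n. \<integral>u. q n u \<partial>\<mu>) \<longlonglongrightarrow> (\<integral>u. - h (T u) \<partial>\<mu>)"
    proof (rule integral_dominated_convergence[where w="\<lambda>_. B"])
      show "(\<lambda>u. - h (T u)) \<in> borel_measurable \<mu>"
        using measurable_compose[OF T' borel_measurable_continuous_onI[OF h]] by simp
      show "AE u in \<mu>. (\<lambda>n. q n u) \<longlonglongrightarrow> - h (T u)"
        using Tmax unfolding q_def
        by eventually_elim (intro conjugate_quotient_tendsto fK hK s, auto)
      show "AE u in \<mu>. norm (q n u) \<le> B" for n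
        using conjugate_quotient_bound[OF fK hK s(1) B(2)] unfolding q_def by simp
    qed (use q_meas in auto)
    moreover have "- (\<integral>v. h v \<partial>\<nu>) \<le> (\<integral>u. q n u \<partial>\<mu>)" for n
    proof -
      have "dual f \<le> dual (\<lambda>x. f x + s n * h x)" by (intro min fsU)
      then have "0 \<le> ((\<integral>u. conjugate (\<lambda>x. f x + s n * h x) u \<partial>\<mu>) - (\<integral>u. conjugate f u \<partial>\<mu>)) + s n * (\<integral>v. h v \<partial>\<nu>)"
        unfolding dual_def using integrable_continuous(2)[OF f] integrable_continuous(2)[OF h] by simp
      then have "0 \<le> (((\<integral>u. conjugate (\<lambda>x. f x + s n * h x) u \<partial>\<mu>) - (\<integral>u. conjugate f u \<partial>\<mu>)) + s n * (\<integral>v. h v \<partial>\<nu>)) / s n"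
        using s(1)[of n] by simp
      also have "\<dots> = (\<integral>u. q n u \<partial>\<mu>) + (\<integral>v. h v \<partial>\<nu>)"
        unfolding q_def using s(1)[of n] integrable_continuous(1)[OF continuous_conjugate[OF fK]]
          integrable_continuous(1)[OF continuous_conjugate[OF fs]]
        by (simp add: add_divide_distrib)
      finally show ?thesis by simp
    qed
    ultimately have "- (\<integral>v. h v \<partial>\<nu>) \<le> (\<integral>u. - h (T u) \<partial>\<mu>)"
      by (intro LIMSEQ_le_const) auto
    then show ?thesis by simp
  qed
  show ?thesis
  proof (rule measure_eqI_continuous)
    show "finite_measure (distr \<mu> borel T)" by (intro \<mu>.finite_measure_distr T')
    fix h :: "'a \<Rightarrow> real" assume h: "continuous_on UNIV h"
    have "(\<integral>x. h x \<partial>distr \<mu> borel T) = (\<integral>u. h (T u) \<partial>\<mu>)"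
      by (intro integral_distr T' borel_measurable_continuous_onI h)
    also have "\<dots> = (\<integral>x. h x \<partial>\<nu>)"
      using var[OF h] var[OF continuous_on_minus[OF h]] by simp
    finally show "(\<integral>x. h x \<partial>distr \<mu> borel T) = (\<integral>x. h x \<partial>\<nu>)" .
  qed (use sets_\<nu> \<nu>.finite_measure_axioms in auto)
qed

text \<open>\<open>T\<close> and \<open>R\<close> are the almost everywhere defined gradients of the two conjugate potentials,
  read through the bilinear form.\<close>

lemma ex_transport_bijection:
  assumes ac: "absolutely_continuous lborel \<mu>" "absolutely_continuous lborel \<nu>"
    and W: "W \<in> sets borel" "W \<subseteq> K" and AE_W: "AE u in \<mu>. u \<in> W" "AE v in \<nu>. v \<in> W"
  obtains f g T R D E where
    "continuous_on UNIV f" "continuous_on UNIV g" "\<And>u v. u \<in> K \<Longrightarrow> v \<in> K \<Longrightarrow> u \<bullet> A v \<le> f u + g v"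
    "D \<in> sets borel" "E \<in> sets borel" "D \<subseteq> W" "E \<subseteq> W" "AE u in \<mu>. u \<in> D" "AE v in \<nu>. v \<in> E"
    "borel_iso_on D E T R" "distr \<mu> borel T = \<nu>"
    "\<And>u v. u \<in> D \<Longrightarrow> v \<in> K \<Longrightarrow> f u + g v = u \<bullet> A v \<longleftrightarrow> v = T u"
proof -
  obtain g0 where g0: "continuous_on K g0"
    and min: "\<And>h. continuous_on UNIV h \<Longrightarrow> dual (conjugate (conjugate g0)) \<le> dual h"
    using ex_dual_minimizer by blast
  define f where "f = conjugate g0"
  define g where "g = conjugate f"
  have f: "continuous_on S f" for S unfolding f_def by (intro continuous_conjugate g0)
  have g: "continuous_on S g" for S unfolding g_def by (intro continuous_conjugate f)
  have conj_g: "conjugate g u = f u" if "u \<in> K" for u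
    unfolding g_def f_def by (rule triconjugate[OF g0 that])
  obtain T N where N: "N \<in> null_sets lborel" and T: "T \<in> borel_measurable borel"
    and Tmax: "\<And>u. u \<notin> N \<Longrightarrow> maximizer g u (T u)" "\<And>u w. u \<notin> N \<Longrightarrow> maximizer g u w \<Longrightarrow> w = T u"
    by (rule ex_maximizer_map[OF g]) blast
  obtain R N' where N': "N' \<in> null_sets lborel" and R: "R \<in> borel_measurable borel"
    and Rmax: "\<And>v. v \<notin> N' \<Longrightarrow> maximizer f v (R v)" "\<And>v w. v \<notin> N' \<Longrightarrow> maximizer f v w \<Longrightarrow> w = R v"
    by (rule ex_maximizer_map[OF f]) blast
  have NN: "N \<in> sets borel" "N' \<in> sets borel" using N N' by (auto dest: null_setsD2)
  have AE_N: "AE u in \<mu>. u \<notin> N" "AE v in \<nu>. v \<notin> N'"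
    using ac N N' by (auto intro!: AE_not_in simp: absolutely_continuous_def)
  have distr: "distr \<mu> borel T = \<nu>"
  proof (rule distr_maximizer_map[OF g _ T])
    show "dual g \<le> dual h" if "continuous_on UNIV h" for h
      using min[OF that] unfolding g_def f_def .
    show "AE u in \<mu>. maximizer g u (T u) \<and> (\<forall>w. maximizer g u w \<longrightarrow> w = T u)"
      using AE_N(1) by eventually_elim (use Tmax in blast)
  qed
  define D where "D = (W - N) \<inter> T -` (W - N')"
  define E where "E = (W - N') \<inter> R -` (W - N)"
  have D: "D \<in> sets borel" unfolding D_def
    using measurable_sets[OF T, of "W - N'"] W NN by auto
  have E: "E \<in> sets borel" unfolding E_def
    using measurable_sets[OF R, of "W - N"] W NN by auto
  have RT: "R (T u) = u" if "u \<in> D" for u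
  proof -
    have u: "u \<in> K" "u \<notin> N" "T u \<notin> N'" using that W by (auto simp: D_def)
    have "maximizer f (T u) u"
      using Tmax(1)[OF u(2)] conj_g[OF u(1)] u(1) self_adjoint[of u "T u"]
      unfolding maximizer_def g_def by simp
    then show ?thesis using Rmax(2)[OF u(3)] by auto
  qed
  have TR: "T (R v) = v" if "v \<in> E" for v
  proof -
    have v: "v \<in> K" "v \<notin> N'" "R v \<in> K" "R v \<notin> N" using that W by (auto simp: E_def)
    have "maximizer g (R v) v"
      using Rmax(1)[OF v(2)] conj_g[OF v(3)] v(1) self_adjoint[of v "R v"]
      unfolding maximizer_def g_def by simp
    then show ?thesis using Tmax(2)[OF v(4)] by auto
  qed
  have TD: "T \<in> D \<rightarrow> E" using RT by (auto simp: D_def E_def)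
  have RE: "R \<in> E \<rightarrow> D" using TR by (auto simp: D_def E_def)
  have T': "T \<in> \<mu> \<rightarrow>\<^sub>M borel" using T by simp
  have "AE v in distr \<mu> borel T. v \<in> W - N'"
    unfolding distr using AE_W(2) AE_N(2) by eventually_elim auto
  then have "AE u in \<mu>. T u \<in> W - N'"
    using W NN by (subst (asm) AE_distr_iff[OF T']) auto
  with AE_W(1) AE_N(1) have AE_D: "AE u in \<mu>. u \<in> D"
    by eventually_elim (auto simp: D_def)
  then have "AE u in \<mu>. T u \<in> E" by eventually_elim (use TD in auto)
  then have "AE v in distr \<mu> borel T. v \<in> E"
    using E by (subst AE_distr_iff[OF T']) auto
  then have AE_E: "AE v in \<nu>. v \<in> E" unfolding distr .
  have iso: "borel_iso_on D E T R"
    using T R TD RE RT TR by (simp add: borel_iso_on_def)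
  show ?thesis
  proof (rule that[OF f g _ D E _ _ AE_D AE_E iso distr])
    show "u \<bullet> A v \<le> f u + g v" if "u \<in> K" "v \<in> K" for u v
      using conjugate_upper[OF f that(1), of v] self_adjoint[of u v] unfolding g_def by linarith
    show "f u + g v = u \<bullet> A v \<longleftrightarrow> v = T u" if "u \<in> D" "v \<in> K" for u v
    proof -
      have u: "u \<in> K" "u \<notin> N" using that W by (auto simp: D_def)
      have "f u + g v = u \<bullet> A v \<longleftrightarrow> maximizer g u v"
        using conj_g[OF u(1)] that(2) by (auto simp: maximizer_def)
      then show ?thesis using Tmax[OF u(2)] by blast
    qed
  qed (auto simp: D_def E_def)
qed

end

section \<open>Disintegration and absolute continuity\<close>

lemma countable_generator_borel_on:
  fixes S :: "'a::second_countable_topology set"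
  obtains E where "countable E" "Int_stable E" "E \<subseteq> Pow S" "S \<in> E" "sets (borel_on S) = sigma_sets S E"
proof -
  obtain B :: "'a set set" where B: "countable B" "topological_basis B"
    using ex_countable_basis by blast
  define G where "G = Inter ` {F. finite F \<and> F \<subseteq> B}"
  have GG: "\<Inter>F \<in> G" if "finite F" "F \<subseteq> B" for F unfolding G_def using that by blast
  have cG: "countable G"
    unfolding G_def using countable_Collect_finite_subset[OF B(1)] by (rule countable_image)
  have UG: "UNIV \<in> G" using GG[of "{}"] by simp
  have IG: "U \<inter> V \<in> G" if UV: "U \<in> G" "V \<in> G" for U V
  proof -
    obtain F F' where F: "finite F" "F \<subseteq> B" "U = \<Inter>F" and F': "finite F'" "F' \<subseteq> B" "V = \<Inter>F'"
      using UV unfolding G_def by auto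
    have "U \<inter> V = \<Inter>(F \<union> F')" using F F' by auto
    then show ?thesis using GG[of "F \<union> F'"] F F' by simp
  qed
  have sb: "sets (borel :: 'a measure) = sigma_sets UNIV G"
  proof (rule antisym)
    have "sets (borel :: 'a measure) = sigma_sets UNIV B"
      by (subst borel_eq_countable_basis[OF B]) simp
    also have "\<dots> \<subseteq> sigma_sets UNIV G"
      using GG[of "{b}" for b] by (intro sigma_sets_mono') auto
    finally show "sets (borel :: 'a measure) \<subseteq> sigma_sets UNIV G" .
    have "U \<in> sets borel" if U: "U \<in> G" for U
    proof -
      obtain F where F: "F \<in> {F. finite F \<and> F \<subseteq> B}" "U = \<Inter>F" using U unfolding G_def by (rule imageE)
      then have "open U" using topological_basis_open[OF B(2)] by (auto intro!: open_Inter)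
      then show ?thesis by simp
    qed
    then show "sigma_sets UNIV G \<subseteq> sets (borel :: 'a measure)"
      using sets.sigma_sets_subset[of G borel] by auto
  qed
  show ?thesis
  proof (rule that)
    show "countable ((\<lambda>U. U \<inter> S) ` G)" using cG by simp
    show "Int_stable ((\<lambda>U. U \<inter> S) ` G)"
    proof (rule Int_stableI)
      fix a b assume "a \<in> (\<lambda>U. U \<inter> S) ` G" "b \<in> (\<lambda>U. U \<inter> S) ` G"
      then obtain U V where UV: "U \<in> G" "V \<in> G" "a = U \<inter> S" "b = V \<inter> S" by auto
      then have "a \<inter> b = (U \<inter> V) \<inter> S" by auto
      then show "a \<inter> b \<in> (\<lambda>U. U \<inter> S) ` G" using IG[OF UV(1,2)] by blast
    qed
    show "(\<lambda>U. U \<inter> S) ` G \<subseteq> Pow S" by auto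
    show "S \<in> (\<lambda>U. U \<inter> S) ` G" using UG by (intro image_eqI[of _ _ UNIV]) auto
    have "sets (borel_on S) = (\<lambda>U. U \<inter> S) ` sigma_sets UNIV G"
      by (auto simp: sets_restrict_space sb Int_commute)
    also have "\<dots> = sigma_sets S ((\<lambda>U. U \<inter> S) ` G)"
      using sigma_sets_vimage_commute[of "\<lambda>x. x" S UNIV G] by (simp add: Setcompr_eq_image)
    finally show "sets (borel_on S) = sigma_sets S ((\<lambda>U. U \<inter> S) ` G)" .
  qed
qed

lemma prob_algebra_cong: "sets M = sets N \<Longrightarrow> prob_algebra M = prob_algebra N"
  unfolding prob_algebra_def by (simp cong: subprob_algebra_cong)

lemma AE_kernel_absolutely_continuous:
  fixes S :: "'b::second_countable_topology set"
  assumes \<mu>: "prob_space \<mu>" and \<nu>: "prob_space \<nu>" "sets \<nu> = sets (borel_on S)"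
    and \<kappa>: "\<kappa> \<in> \<mu> \<rightarrow>\<^sub>M prob_algebra \<nu>"
    and J: "sets J = sets (\<mu> \<Otimes>\<^sub>M \<nu>)" "absolutely_continuous (\<mu> \<Otimes>\<^sub>M \<nu>) J"
    and rect: "\<And>A B. A \<in> sets \<mu> \<Longrightarrow> B \<in> sets \<nu> \<Longrightarrow>
      emeasure J (A \<times> B) = (\<integral>\<^sup>+x. emeasure (\<kappa> x) B * indicator A x \<partial>\<mu>)"
  shows "AE x in \<mu>. absolutely_continuous \<nu> (\<kappa> x)"
proof -
  interpret \<mu>: prob_space \<mu> by fact
  interpret \<nu>: prob_space \<nu> by fact
  interpret pair_prob_space \<mu> \<nu> ..
  obtain E where E: "countable E" "Int_stable E" "E \<subseteq> Pow S" "S \<in> E" "sets (borel_on S) = sigma_sets S E"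
    by (rule countable_generator_borel_on)
  have E\<nu>: "B \<in> sets \<nu>" if "B \<in> E" for B using that E(5) \<nu>(2) by auto
  have sp\<nu>: "space \<nu> = S" using sets_eq_imp_space_eq[OF \<nu>(2)] by (simp add: space_restrict_space)
  define g where "g = RN_deriv (\<mu> \<Otimes>\<^sub>M \<nu>) J"
  have g[measurable]: "g \<in> borel_measurable (\<mu> \<Otimes>\<^sub>M \<nu>)" unfolding g_def by simp
  have dens: "density (\<mu> \<Otimes>\<^sub>M \<nu>) g = J"
    unfolding g_def using J(2,1) by (rule P.density_RN_deriv)
  have \<kappa>s: "\<kappa> \<in> \<mu> \<rightarrow>\<^sub>M subprob_algebra \<nu>" using \<kappa> by (rule measurable_prob_algebraD)
  have eq: "AE x in \<mu>. emeasure (\<kappa> x) B = (\<integral>\<^sup>+y. g (x, y) * indicator B y \<partial>\<nu>)" if B: "B \<in> E" for B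
  proof (rule \<mu>.density_unique2)
    have Bm[measurable]: "B \<in> sets \<nu>" using E\<nu>[OF B] .
    show "(\<lambda>x. emeasure (\<kappa> x) B) \<in> borel_measurable \<mu>"
      using measurable_emeasure_kernel[OF \<kappa>s Bm] .
    show "(\<lambda>x. \<integral>\<^sup>+y. g (x, y) * indicator B y \<partial>\<nu>) \<in> borel_measurable \<mu>" by measurable
    fix A assume A[measurable]: "A \<in> sets \<mu>"
    have "(\<integral>\<^sup>+x\<in>A. emeasure (\<kappa> x) B \<partial>\<mu>) = emeasure J (A \<times> B)" by (simp add: rect)
    also have "\<dots> = (\<integral>\<^sup>+z. g z * indicator (A \<times> B) z \<partial>(\<mu> \<Otimes>\<^sub>M \<nu>))"
      unfolding dens[symmetric] by (subst emeasure_density) auto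
    also have "\<dots> = (\<integral>\<^sup>+x. \<integral>\<^sup>+y. g (x, y) * indicator (A \<times> B) (x, y) \<partial>\<nu> \<partial>\<mu>)"
      by (subst \<nu>.nn_integral_fst[symmetric]) auto
    also have "\<dots> = (\<integral>\<^sup>+x\<in>A. (\<integral>\<^sup>+y. g (x, y) * indicator B y \<partial>\<nu>) \<partial>\<mu>)"
      by (intro nn_integral_cong) (auto simp: indicator_def)
    finally show "(\<integral>\<^sup>+x\<in>A. emeasure (\<kappa> x) B \<partial>\<mu>) = (\<integral>\<^sup>+x\<in>A. (\<integral>\<^sup>+y. g (x, y) * indicator B y \<partial>\<nu>) \<partial>\<mu>)" .
  qed
  have "AE x in \<mu>. \<forall>B\<in>E. emeasure (\<kappa> x) B = (\<integral>\<^sup>+y. g (x, y) * indicator B y \<partial>\<nu>)"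
    using eq by (simp add: AE_ball_countable[OF E(1)])
  then show ?thesis
    using AE_space
  proof eventually_elim
    case (elim x)
    have gx[measurable]: "(\<lambda>y. g (x, y)) \<in> borel_measurable \<nu>"
      using elim(2) by measurable
    have \<kappa>x: "prob_space (\<kappa> x)" "sets (\<kappa> x) = sets \<nu>"
      using measurable_space[OF \<kappa> elim(2)] by (auto simp: space_prob_algebra)
    interpret \<kappa>x: prob_space "\<kappa> x" by fact
    have "\<kappa> x = density \<nu> (\<lambda>y. g (x, y))"
    proof (rule measure_eqI_generator_eq[OF E(2,3), where A="\<lambda>_. S"])
      show "emeasure (\<kappa> x) B = emeasure (density \<nu> (\<lambda>y. g (x, y))) B" if "B \<in> E" for B
        using elim(1) that E\<nu>[OF that] by (simp add: emeasure_density)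
    qed (use E \<kappa>x \<nu> in auto)
    then show ?case by (simp add: absolutely_continuousI_density)
  qed
qed

lemma
  assumes P: "prob_space P" and \<kappa>: "\<kappa> \<in> P \<rightarrow>\<^sub>M prob_algebra N"
  shows sets_joint_law: "sets (joint_law P N \<kappa>) = sets (P \<Otimes>\<^sub>M N)"
    and emeasure_joint_law: "X \<in> sets (P \<Otimes>\<^sub>M N) \<Longrightarrow>
      emeasure (joint_law P N \<kappa>) X = (\<integral>\<^sup>+x. emeasure (\<kappa> x) (Pair x -` X) \<partial>P)"
    and sets_output_law: "sets (output_law P \<kappa>) = sets N"
    and emeasure_output_law: "B \<in> sets N \<Longrightarrow> emeasure (output_law P \<kappa>) B = (\<integral>\<^sup>+x. emeasure (\<kappa> x) B \<partial>P)"
    and prob_space_output_law: "prob_space (output_law P \<kappa>)"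
proof -
  interpret P: prob_space P by fact
  have \<kappa>s: "\<kappa> \<in> P \<rightarrow>\<^sub>M subprob_algebra N" using \<kappa> by (rule measurable_prob_algebraD)
  have m: "(\<lambda>x. distr (\<kappa> x) (P \<Otimes>\<^sub>M N) (Pair x)) \<in> P \<rightarrow>\<^sub>M subprob_algebra (P \<Otimes>\<^sub>M N)"
    using \<kappa>s by (intro measurable_distr2[where M=N]) auto
  show "sets (joint_law P N \<kappa>) = sets (P \<Otimes>\<^sub>M N)"
    unfolding joint_law_def by (rule sets_bind[OF sets_kernel[OF m] P.not_empty])
  show "emeasure (joint_law P N \<kappa>) X = (\<integral>\<^sup>+x. emeasure (\<kappa> x) (Pair x -` X) \<partial>P)"
    if X: "X \<in> sets (P \<Otimes>\<^sub>M N)"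
  proof -
    have "emeasure (joint_law P N \<kappa>) X = (\<integral>\<^sup>+x. emeasure (distr (\<kappa> x) (P \<Otimes>\<^sub>M N) (Pair x)) X \<partial>P)"
      unfolding joint_law_def by (rule emeasure_bind[OF P.not_empty m X])
    also have "\<dots> = (\<integral>\<^sup>+x. emeasure (\<kappa> x) (Pair x -` X) \<partial>P)"
    proof (rule nn_integral_cong)
      fix x assume x: "x \<in> space P"
      have s: "sets (\<kappa> x) = sets N" by (rule sets_kernel[OF \<kappa>s x])
      have "Pair x \<in> \<kappa> x \<rightarrow>\<^sub>M P \<Otimes>\<^sub>M N" unfolding measurable_cong_sets[OF s refl] using x by measurable
      moreover have "Pair x -` X \<inter> space (\<kappa> x) = Pair x -` X"
        using sets.sets_into_space[OF X] sets_eq_imp_space_eq[OF s] by (auto simp: space_pair_measure)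
      ultimately show "emeasure (distr (\<kappa> x) (P \<Otimes>\<^sub>M N) (Pair x)) X = emeasure (\<kappa> x) (Pair x -` X)"
        using X by (simp add: emeasure_distr)
    qed
    finally show ?thesis .
  qed
  show "sets (output_law P \<kappa>) = sets N"
    unfolding output_law_def by (rule sets_bind[OF sets_kernel[OF \<kappa>s] P.not_empty])
  show "emeasure (output_law P \<kappa>) B = (\<integral>\<^sup>+x. emeasure (\<kappa> x) B \<partial>P)" if "B \<in> sets N"
    unfolding output_law_def by (rule emeasure_bind[OF P.not_empty \<kappa>s that])
  have "AE x in P. prob_space (\<kappa> x)"
    using measurable_space[OF \<kappa>] by (intro AE_I2) (auto simp: space_prob_algebra)
  then show "prob_space (output_law P \<kappa>)"
    unfolding output_law_def by (rule P.prob_space_bind[OF _ \<kappa>s])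
qed

lemma emeasure_joint_law_Times:
  assumes P: "prob_space P" and \<kappa>: "\<kappa> \<in> P \<rightarrow>\<^sub>M prob_algebra N" and A: "A \<in> sets P" and B: "B \<in> sets N"
  shows "emeasure (joint_law P N \<kappa>) (A \<times> B) = (\<integral>\<^sup>+x. emeasure (\<kappa> x) B * indicator A x \<partial>P)"
  using A B by (subst emeasure_joint_law[OF P \<kappa>])
    (auto intro!: nn_integral_cong simp: indicator_def vimage_def)

lemma distr_snd_joint_law:
  assumes P: "prob_space P" and \<kappa>: "\<kappa> \<in> P \<rightarrow>\<^sub>M prob_algebra N"
  shows "distr (joint_law P N \<kappa>) N snd = output_law P \<kappa>"
proof (rule measure_eqI)
  show "sets (distr (joint_law P N \<kappa>) N snd) = sets (output_law P \<kappa>)"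
    by (simp add: sets_output_law[OF P \<kappa>])
  fix B assume "B \<in> sets (distr (joint_law P N \<kappa>) N snd)"
  then have B: "B \<in> sets N" by simp
  have J: "sets (joint_law P N \<kappa>) = sets (P \<Otimes>\<^sub>M N)" by (rule sets_joint_law[OF P \<kappa>])
  have snd: "snd \<in> joint_law P N \<kappa> \<rightarrow>\<^sub>M N" unfolding measurable_cong_sets[OF J refl] by simp
  have "snd -` B \<inter> space (joint_law P N \<kappa>) = space P \<times> B"
    using sets.sets_into_space[OF B] by (auto simp: sets_eq_imp_space_eq[OF J] space_pair_measure)
  then have "emeasure (distr (joint_law P N \<kappa>) N snd) B = emeasure (joint_law P N \<kappa>) (space P \<times> B)"
    using B snd by (simp add: emeasure_distr)
  also have "\<dots> = emeasure (output_law P \<kappa>) B"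
    using B by (subst emeasure_joint_law_Times[OF P \<kappa>])
      (auto intro!: nn_integral_cong simp: emeasure_output_law[OF P \<kappa>])
  finally show "emeasure (distr (joint_law P N \<kappa>) N snd) B = emeasure (output_law P \<kappa>) B" .
qed

lemma absolutely_continuous_joint_law:
  assumes P: "prob_space P" and \<kappa>: "\<kappa> \<in> P \<rightarrow>\<^sub>M prob_algebra N"
    and \<nu>: "prob_space \<nu>" "sets \<nu> = sets N" and ac: "AE x in P. absolutely_continuous \<nu> (\<kappa> x)"
  shows "absolutely_continuous (P \<Otimes>\<^sub>M \<nu>) (joint_law P N \<kappa>)"
  unfolding absolutely_continuous_def
proof
  interpret P: prob_space P by fact
  interpret \<nu>: prob_space \<nu> by fact
  have sP: "sets (P \<Otimes>\<^sub>M \<nu>) = sets (P \<Otimes>\<^sub>M N)" by (intro sets_pair_measure_cong refl \<nu>)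
  fix X assume X: "X \<in> null_sets (P \<Otimes>\<^sub>M \<nu>)"
  then have Xm: "X \<in> sets (P \<Otimes>\<^sub>M \<nu>)" "X \<in> sets (P \<Otimes>\<^sub>M N)" using sP by auto
  have "(\<integral>\<^sup>+x. emeasure \<nu> (Pair x -` X) \<partial>P) = 0"
    using X \<nu>.emeasure_pair_measure_alt[OF Xm(1)] by auto
  then have "AE x in P. emeasure \<nu> (Pair x -` X) = 0"
    using \<nu>.measurable_emeasure_Pair[OF Xm(1)] by (simp add: nn_integral_0_iff_AE)
  with ac have "AE x in P. emeasure (\<kappa> x) (Pair x -` X) = 0"
  proof eventually_elim
    case (elim x)
    then have "Pair x -` X \<in> null_sets \<nu>" using sets_Pair1[OF Xm(1)] by auto
    then show ?case using elim(1) unfolding absolutely_continuous_def by auto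
  qed
  then have "emeasure (joint_law P N \<kappa>) X = 0"
    by (simp add: emeasure_joint_law[OF P \<kappa> Xm(2)] cong: nn_integral_cong_AE)
  then show "X \<in> null_sets (joint_law P N \<kappa>)"
    using Xm(2) sets_joint_law[OF P \<kappa>] by auto
qed

lemma AE_cond_law_absolutely_continuous:
  fixes W :: "'a::second_countable_topology set" and Y :: "'b::second_countable_topology set"
  assumes P: "prob_space P" "sets P = sets (borel_on W)"
    and K: "K \<in> NX \<rightarrow>\<^sub>M prob_algebra (borel_on Y)" and \<phi>: "\<phi> \<in> P \<rightarrow>\<^sub>M NX"
    and ac: "absolutely_continuous (distr P NX \<phi> \<Otimes>\<^sub>M output_law (distr P NX \<phi>) K)
        (joint_law (distr P NX \<phi>) (borel_on Y) K)"
    and cond: "regular_cond_law (borel_on W) (borel_on Y) (joint_law P (borel_on Y) (\<lambda>w. K (\<phi> w))) Q"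
  shows "AE y in distr (joint_law P (borel_on Y) (\<lambda>w. K (\<phi> w))) (borel_on Y) snd. absolutely_continuous P (Q y)"
proof -
  interpret P: prob_space P by fact
  define PX where "PX = distr P NX \<phi>"
  define J where "J = joint_law P (borel_on Y) (\<lambda>w. K (\<phi> w))"
  define PY where "PY = distr J (borel_on Y) snd"
  have PX: "prob_space PX" unfolding PX_def by (rule P.prob_space_distr[OF \<phi>])
  have KX: "K \<in> PX \<rightarrow>\<^sub>M prob_algebra (borel_on Y)" using K by (simp add: PX_def)
  have K\<phi>: "(\<lambda>w. K (\<phi> w)) \<in> P \<rightarrow>\<^sub>M prob_algebra (borel_on Y)" by (rule measurable_compose[OF \<phi> K])
  have PY_out: "PY = output_law P (\<lambda>w. K (\<phi> w))"
    unfolding PY_def J_def by (rule distr_snd_joint_law[OF P(1) K\<phi>])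
  have out: "output_law PX K = PY"
  proof (rule measure_eqI)
    show "sets (output_law PX K) = sets PY" by (simp add: sets_output_law[OF PX KX] PY_def)
    fix B assume "B \<in> sets (output_law PX K)"
    then have B: "B \<in> sets (borel_on Y)" by (simp add: sets_output_law[OF PX KX])
    show "emeasure (output_law PX K) B = emeasure PY B"
      unfolding PY_out emeasure_output_law[OF PX KX B] emeasure_output_law[OF P(1) K\<phi> B]
      unfolding PX_def by (intro nn_integral_distr \<phi>)
        (simp add: measurable_emeasure_kernel[OF measurable_prob_algebraD[OF K] B])
  qed
  have PY: "prob_space PY" "sets PY = sets (borel_on Y)"
    using prob_space_output_law[OF P(1) K\<phi>] unfolding PY_out[symmetric] by (simp_all add: PY_def)
  interpret PY: prob_space PY by (rule PY)
  have "AE x in PX. absolutely_continuous PY (K x)"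
  proof (rule AE_kernel_absolutely_continuous[OF PX PY])
    show "K \<in> PX \<rightarrow>\<^sub>M prob_algebra PY" using KX prob_algebra_cong[OF PY(2)] by simp
    show "sets (joint_law PX (borel_on Y) K) = sets (PX \<Otimes>\<^sub>M PY)"
      unfolding sets_joint_law[OF PX KX] by (intro sets_pair_measure_cong refl PY(2)[symmetric])
    show "absolutely_continuous (PX \<Otimes>\<^sub>M PY) (joint_law PX (borel_on Y) K)"
      using ac unfolding PX_def[symmetric] out .
  qed (use emeasure_joint_law_Times[OF PX KX] PY(2) in auto)
  then have "AE w in P. absolutely_continuous PY (K (\<phi> w))"
    unfolding PX_def by (rule AE_distrD[OF \<phi>])
  then have acJ: "absolutely_continuous (P \<Otimes>\<^sub>M PY) J"
    unfolding J_def by (rule absolutely_continuous_joint_law[OF P(1) K\<phi> PY])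
  have sJ: "sets J = sets (P \<Otimes>\<^sub>M PY)"
    unfolding J_def sets_joint_law[OF P(1) K\<phi>] by (intro sets_pair_measure_cong refl PY(2)[symmetric])
  interpret PP: pair_sigma_finite PY P ..
  let ?swap = "\<lambda>(x, y). (y, x)"
  have swap: "?swap \<in> P \<Otimes>\<^sub>M PY \<rightarrow>\<^sub>M PY \<Otimes>\<^sub>M P" by measurable
  then have swapJ: "?swap \<in> J \<rightarrow>\<^sub>M PY \<Otimes>\<^sub>M P" by (simp cong: measurable_cong_sets add: sJ)
  define J' where "J' = distr J (PY \<Otimes>\<^sub>M P) ?swap"
  have acJ': "absolutely_continuous (PY \<Otimes>\<^sub>M P) J'"
    unfolding absolutely_continuous_def
  proof
    fix X assume "X \<in> null_sets (PY \<Otimes>\<^sub>M P)"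
    then have X: "X \<in> sets (PY \<Otimes>\<^sub>M P)" "?swap -` X \<inter> space (P \<Otimes>\<^sub>M PY) \<in> null_sets (P \<Otimes>\<^sub>M PY)"
      by (subst (asm) PP.distr_pair_swap, simp add: null_sets_distr_iff[OF swap])+
    then have "?swap -` X \<inter> space J \<in> null_sets J"
      using acJ sets_eq_imp_space_eq[OF sJ] unfolding absolutely_continuous_def by auto
    then show "X \<in> null_sets J'"
      unfolding J'_def using X(1) by (simp add: null_sets_distr_iff[OF swapJ])
  qed
  have Q: "Q \<in> borel_on Y \<rightarrow>\<^sub>M prob_algebra (borel_on W)"
    and Qrect: "\<And>A B. A \<in> sets (borel_on W) \<Longrightarrow> B \<in> sets (borel_on Y) \<Longrightarrow>
      emeasure J (A \<times> B) = (\<integral>\<^sup>+y\<in>B. emeasure (Q y) A \<partial>PY)"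
    using cond unfolding regular_cond_law_def J_def[symmetric] PY_def by auto
  have "AE y in PY. absolutely_continuous P (Q y)"
  proof (rule AE_kernel_absolutely_continuous[OF PY(1) P])
    show "Q \<in> PY \<rightarrow>\<^sub>M prob_algebra P"
      using Q prob_algebra_cong[OF P(2)] by (simp cong: measurable_cong_sets add: PY(2))
    show "sets J' = sets (PY \<Otimes>\<^sub>M P)" by (simp add: J'_def)
    fix B A assume BA: "B \<in> sets PY" "A \<in> sets P"
    then have "?swap -` (B \<times> A) \<inter> space J = A \<times> B"
      using sets.sets_into_space[OF BA(1)] sets.sets_into_space[OF BA(2)]
      by (auto simp: sets_eq_imp_space_eq[OF sJ] space_pair_measure)
    then have "emeasure J' (B \<times> A) = emeasure J (A \<times> B)"
      unfolding J'_def using BA by (subst emeasure_distr[OF swapJ]) auto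
    also have "\<dots> = (\<integral>\<^sup>+y. emeasure (Q y) A * indicator B y \<partial>PY)"
      using Qrect[of A B] BA P(2) PY(2) by simp
    finally show "emeasure J' (B \<times> A) = (\<integral>\<^sup>+y. emeasure (Q y) A * indicator B y \<partial>PY)" .
  qed (rule acJ')
  then show ?thesis unfolding PY_def J_def .
qed

section \<open>Optimal maps for a quadratic cost\<close>

lemma sets_uniform_on: "sets (uniform_on W) = sets (borel_on W)"
  unfolding uniform_on_def by (simp add: sets_restrict_space)

lemma space_uniform_on: "space (uniform_on W) = W"
  using sets_eq_imp_space_eq[OF sets_uniform_on] by (simp add: space_restrict_space)

lemma
  fixes W :: "'a::euclidean_space set"
  assumes W: "open W" "bounded W" "W \<noteq> {}"
  shows prob_space_uniform_on: "prob_space (uniform_on W)"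
    and null_sets_uniform_on: "N \<in> null_sets lborel \<Longrightarrow> N \<inter> W \<in> null_sets (uniform_on W)"
proof -
  have Wm: "W \<in> sets borel" using W by simp
  have eW: "emeasure (restrict_space lborel W) B = emeasure lborel B" if "B \<subseteq> W" for B
    using Wm that by (simp add: emeasure_restrict_space)
  have "emeasure lborel W \<noteq> 0"
    using open_not_negligible[OF W(1,3)] Wm by (simp add: negligible_iff_emeasure0)
  moreover have "emeasure lborel W < \<infinity>" using emeasure_bounded_finite[OF W(2)] by simp
  ultimately show "prob_space (uniform_on W)"
    unfolding uniform_on_def by (intro prob_space_uniform_measure) (simp_all add: eW)
  show "N \<inter> W \<in> null_sets (uniform_on W)" if N: "N \<in> null_sets lborel"
  proof -
    have Nm: "N \<in> sets borel" using N by (auto dest: null_setsD2)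
    have s: "N \<inter> W \<in> sets (restrict_space lborel W)" "W \<in> sets (restrict_space lborel W)"
      using Nm Wm by (auto simp: sets_restrict_space_iff)
    have "N \<inter> W \<in> null_sets lborel" using N Wm by (intro null_set_Int2) auto
    then have "emeasure (uniform_on W) (N \<inter> W) = 0"
      unfolding uniform_on_def using s by (simp add: emeasure_uniform_measure eW Int_absorb1 null_setsD1)
    then show ?thesis using s by (auto simp: uniform_on_def null_sets_def)
  qed
qed

lemma ex_unique_invertible_optimal_map:
  fixes W :: "(real ^ 'n) set" and M :: "real ^ 'n ^ 'n"
  assumes W: "open W" "bounded W" "W \<noteq> {}" and M: "pos_def M"
    and P: "prob_space P" "sets P = sets (borel_on W)" "absolutely_continuous (uniform_on W) P"
  shows "\<exists>S. optimal_map (quad_cost M) P (uniform_on W) S \<and> borel_invertible_on W S \<and>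
    (\<forall>T. optimal_map (quad_cost M) P (uniform_on W) T \<longrightarrow> (AE u in P. T u = S u))"
proof -
  define A where "A v = M *v v + transpose M *v v" for v
  define K where "K = closure W"
  define U where "U = uniform_on W"
  define \<mu> where "\<mu> = distr P borel (\<lambda>u. u)"
  define \<nu> where "\<nu> = distr U borel (\<lambda>u. u)"
  interpret P: prob_space P by (rule P(1))
  interpret U: prob_space U unfolding U_def by (rule prob_space_uniform_on[OF W])
  have Wm[measurable]: "W \<in> sets borel" using W by simp
  have sU: "sets U = sets (borel_on W)" unfolding U_def by (rule sets_uniform_on)
  have spP: "space P = W" using sets_eq_imp_space_eq[OF P(2)] by (simp add: space_restrict_space)
  have spU: "space U = W" unfolding U_def by (rule space_uniform_on)
  have idW: "(\<lambda>u. u) \<in> borel_on W \<rightarrow>\<^sub>M borel" by (rule measurable_restrict_space1) simp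
  have idP: "(\<lambda>u. u) \<in> P \<rightarrow>\<^sub>M borel" using idW unfolding measurable_cong_sets[OF P(2) refl] .
  have idU: "(\<lambda>u. u) \<in> U \<rightarrow>\<^sub>M borel" using idW unfolding measurable_cong_sets[OF sU refl] .
  have transpose_inner: "u \<bullet> (v v* M) = v \<bullet> (M *v u)" for u v
    by (metis dot_lmul_matrix inner_commute)
  have WK: "W \<subseteq> K" unfolding K_def by (rule closure_subset)
  have nullU: "N \<inter> W \<in> null_sets U" if "N \<in> null_sets lborel" for N
    unfolding U_def by (rule null_sets_uniform_on[OF W that])
  have lin: "linear A"
    unfolding A_def by (intro linear_compose_add matrix_vector_mul_linear)
  interpret transport_pair A K \<mu> \<nu>
  proof (intro transport_pair.intro bilinear_conjugate.intro transport_pair_axioms.intro)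
    show "linear A" by (rule lin)
    show "u \<bullet> A v = v \<bullet> A u" for u v
      unfolding A_def by (simp add: inner_add_right transpose_inner)
    show "inj A"
    proof (rule linear_injective_0[THEN iffD2, OF lin], intro allI impI, rule ccontr)
      fix v assume "A v = 0" "v \<noteq> 0"
      then have "v \<bullet> A v = 0" by simp
      then have "v \<bullet> (M *v v) + v \<bullet> (M *v v) = 0"
        unfolding A_def by (simp add: inner_add_right transpose_inner)
      moreover have "0 < v \<bullet> (M *v v)" using M \<open>v \<noteq> 0\<close> unfolding pos_def_def by blast
      ultimately show False by simp
    qed
    show "compact K" unfolding K_def using W by (simp add: compact_closure)
    show "K \<noteq> {}" using W WK by auto
    show "prob_space \<mu>" unfolding \<mu>_def by (rule P.prob_space_distr[OF idP])
    show "prob_space \<nu>" unfolding \<nu>_def by (rule U.prob_space_distr[OF idU])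
    have Km: "K \<in> sets borel" unfolding K_def by simp
    show "AE u in \<mu>. u \<in> K" unfolding \<mu>_def
      using WK Km by (subst AE_distr_iff[OF idP]) (auto simp: spP intro!: AE_I2)
    show "AE u in \<nu>. u \<in> K" unfolding \<nu>_def
      using WK Km by (subst AE_distr_iff[OF idU]) (auto simp: spU intro!: AE_I2)
  qed (simp_all add: \<mu>_def \<nu>_def)
  have null_borel: "N \<in> sets borel" if "N \<in> null_sets lborel" for N :: "(real ^ 'n) set"
    using null_setsD2[OF that] by simp
  have acU: "absolutely_continuous lborel \<nu>"
    unfolding absolutely_continuous_def \<nu>_def
    using nullU null_borel by (auto simp: null_sets_distr_iff[OF idU] spU)
  have nullP: "N \<inter> W \<in> null_sets P" if "N \<in> null_sets lborel" for N
    using P(3) nullU[OF that] unfolding absolutely_continuous_def U_def by blast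
  have acP: "absolutely_continuous lborel \<mu>"
    unfolding absolutely_continuous_def \<mu>_def
    using nullP null_borel by (auto simp: null_sets_distr_iff[OF idP] spP)
  have AE_W: "AE u in \<mu>. u \<in> W" "AE v in \<nu>. v \<in> W"
    unfolding \<mu>_def \<nu>_def
    by (auto simp: AE_distr_iff[OF idP] AE_distr_iff[OF idU] spP spU)
  obtain f g T R D E where f: "continuous_on UNIV f" and g: "continuous_on UNIV g"
    and fg: "\<And>u v. u \<in> K \<Longrightarrow> v \<in> K \<Longrightarrow> u \<bullet> A v \<le> f u + g v"
    and D: "D \<in> sets borel" "D \<subseteq> W" "AE u in \<mu>. u \<in> D" and E: "E \<in> sets borel" "E \<subseteq> W"
    and iso: "borel_iso_on D E T R" and distrT: "distr \<mu> borel T = \<nu>"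
    and contact: "\<And>u v. u \<in> D \<Longrightarrow> v \<in> K \<Longrightarrow> f u + g v = u \<bullet> A v \<longleftrightarrow> v = T u"
    by (rule ex_transport_bijection[OF acP acU Wm WK AE_W]) blast
  obtain S S' where isoS: "borel_iso_on W W S S'" and ST: "AE u in \<mu>. S u = T u"
    by (rule extend_borel_iso[OF W(1,3) \<mu>.finite_measure_axioms sets_\<mu> \<nu>.finite_measure_axioms sets_\<nu>
          iso distrT D E]) blast
  have S[measurable]: "S \<in> borel \<rightarrow>\<^sub>M borel" and S'[measurable]: "S' \<in> borel \<rightarrow>\<^sub>M borel"
    and SW: "S \<in> W \<rightarrow> W" "S' \<in> W \<rightarrow> W" and SS': "\<And>u. u \<in> W \<Longrightarrow> S' (S u) = u" "\<And>v. v \<in> W \<Longrightarrow> S (S' v) = v"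
    using isoS by (auto simp: borel_iso_on_def)
  have T: "T \<in> borel \<rightarrow>\<^sub>M borel" using iso by (simp add: borel_iso_on_def)
  have inv: "borel_invertible_on W S"
    unfolding borel_invertible_on_def
  proof (intro conjI)
    show bij: "bij_betw S W W"
      using SW SS' by (intro bij_betwI[of S W W S']) auto
    show "S \<in> borel_on W \<rightarrow>\<^sub>M borel_on W"
      by (rule measurable_restrict_space3[OF S]) (use SW in auto)
    have "S' \<in> borel_on W \<rightarrow>\<^sub>M borel_on W"
      by (rule measurable_restrict_space3[OF S']) (use SW in auto)
    moreover have "the_inv_into W S v = S' v" if "v \<in> W" for v
      using bij SS' SW that by (intro the_inv_into_f_eq) (auto simp: bij_betw_def)
    ultimately show "the_inv_into W S \<in> borel_on W \<rightarrow>\<^sub>M borel_on W"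
      by (subst measurable_cong[where g=S']) (auto simp: space_restrict_space)
  qed
  have SP: "S \<in> P \<rightarrow>\<^sub>M U"
    using inv unfolding borel_invertible_on_def measurable_cong_sets[OF P(2) sU] by simp
  have AE_P: "AE u in P. u \<in> D" "AE u in P. S u = T u"
    using AE_distrD[OF idP] D(3) ST unfolding \<mu>_def by auto
  have S_map: "S \<in> transport_maps P U"
    unfolding transport_maps_def
  proof (intro CollectI conjI SP measure_eqI)
    fix B assume "B \<in> sets (distr P U S)"
    then have BU: "B \<in> sets U" by simp
    then have B: "B \<in> sets borel" "B \<subseteq> W" unfolding sU by (auto simp: sets_restrict_space_iff)
    have S\<mu>: "S \<in> \<mu> \<rightarrow>\<^sub>M borel" "T \<in> \<mu> \<rightarrow>\<^sub>M borel"
      unfolding measurable_cong_sets[OF sets_\<mu> refl] using S T by simp_all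
    have "distr \<mu> borel S = distr \<mu> borel T"
      by (rule distr_cong_AE) (use ST S\<mu> in auto)
    then have "emeasure \<mu> (S -` B) = emeasure \<nu> B"
      using emeasure_distr[OF S\<mu>(1) B(1)] distrT by (simp add: sets_eq_imp_space_eq[OF sets_\<mu>])
    moreover have "emeasure \<mu> (S -` B) = emeasure P (S -` B \<inter> space P)"
      unfolding \<mu>_def using B(1) measurable_sets[OF S, of B] by (simp add: emeasure_distr[OF idP])
    moreover have "emeasure \<nu> B = emeasure U B"
      unfolding \<nu>_def using B by (simp add: emeasure_distr[OF idU] spU Int_absorb2)
    ultimately show "emeasure (distr P U S) B = emeasure U B"
      using BU by (simp add: emeasure_distr[OF SP])
  qed simp
  define a where "a w = w \<bullet> (M *v w)" for w
  have a: "continuous_on UNIV a"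
    unfolding a_def by (intro continuous_intros linear_continuous_on linear_linear[THEN iffD1]
        matrix_vector_mul_linear)
  define slack where "slack V u = f u + g (V u) - u \<bullet> A (V u)" for V u
  define c where "c = (\<integral>u. a u - f u \<partial>P) + (\<integral>v. a v - g v \<partial>U)"
  have bm: "h \<in> borel_measurable borel" if "continuous_on UNIV h" for h :: "real ^ 'n \<Rightarrow> real"
    using that by (rule borel_measurable_continuous_onI)
  have cost: "integrable P (slack V) \<and> (\<forall>u\<in>W. 0 \<le> slack V u) \<and> 0 \<le> c + (\<integral>u. slack V u \<partial>P) \<and>
      transport_cost (quad_cost M) P V = ennreal (c + (\<integral>u. slack V u \<partial>P))"
    if V: "V \<in> transport_maps P U" for V
  proof -
    have VU: "V \<in> P \<rightarrow>\<^sub>M U" and dV: "distr P U V = U" using V by (auto simp: transport_maps_def)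
    have VW: "V u \<in> W" if "u \<in> W" for u using measurable_space[OF VU] that spP spU by auto
    have Vb[measurable]: "V \<in> borel_measurable P" using measurable_compose[OF VU idU] .
    note idP[measurable]
    have comp: "integrable P (\<lambda>u. h (V u))" "integrable P h" if h: "continuous_on UNIV h" for h :: "real ^ 'n \<Rightarrow> real"
    proof -
      obtain B where B: "\<And>v. v \<in> K \<Longrightarrow> \<bar>h v\<bar> \<le> B"
        using continuous_imp_bounded_on_K continuous_on_subset[OF h] by blast
      show "integrable P (\<lambda>u. h (V u))"
        using B VW WK spP measurable_compose[OF Vb bm[OF h]]
        by (intro P.integrable_const_bound[of _ B]) (auto intro!: AE_I2)
      show "integrable P h"
        using B WK spP measurable_compose[OF idP bm[OF h]]
        by (intro P.integrable_const_bound[of _ B]) (auto intro!: AE_I2)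
    qed
    obtain B where B: "0 < B" "\<And>v. v \<in> K \<Longrightarrow> norm v \<le> B"
      using compact_imp_bounded[OF compact_K] unfolding bounded_pos by auto
    have "(\<lambda>u. A (V u)) \<in> borel_measurable P"
      using measurable_compose[OF Vb borel_measurable_continuous_onI[OF continuous_A]] .
    then have "(\<lambda>u. u \<bullet> A (V u)) \<in> borel_measurable P"
      using idP by (intro borel_measurable_inner)
    moreover have "\<bar>u \<bullet> A (V u)\<bar> \<le> B * lip" if "u \<in> W" for u
    proof -
      have "\<bar>u \<bullet> A (V u)\<bar> \<le> norm u * norm (A (V u))" by (rule Cauchy_Schwarz_ineq2)
      also have "\<dots> \<le> B * lip" using B norm_A_le that VW WK by (intro mult_mono) auto
      finally show ?thesis .
    qed
    ultimately have inner: "integrable P (\<lambda>u. u \<bullet> A (V u))"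
      using spP by (intro P.integrable_const_bound[of _ "B * lip"]) (auto intro!: AE_I2)
    have int_slack: "integrable P (slack V)"
      unfolding slack_def using comp[OF f] comp[OF g] inner by simp
    have split: "quad_cost M u (V u) = (a u - f u) + (a (V u) - g (V u)) + slack V u" for u
      unfolding quad_cost_def a_def slack_def A_def
      by (simp add: matrix_vector_mult_diff_distrib inner_diff_left inner_diff_right inner_add_right transpose_inner)
    have ag: "continuous_on UNIV (\<lambda>v. a v - g v)" by (intro continuous_intros a g)
    have ints: "integrable P (\<lambda>u. a u - f u)" "integrable P (\<lambda>u. a (V u) - g (V u))"
      using comp[OF a] comp[OF f] comp[OF g] by auto
    then have int_cost: "integrable P (\<lambda>u. quad_cost M u (V u))"
      unfolding split using int_slack by simp
    have "(\<integral>u. a (V u) - g (V u) \<partial>P) = (\<integral>v. a v - g v \<partial>distr P U V)"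
      by (rule integral_distr[symmetric, OF VU]) (rule measurable_compose[OF idU bm[OF ag]])
    then have int_eq: "(\<integral>u. quad_cost M u (V u) \<partial>P) = c + (\<integral>u. slack V u \<partial>P)"
      unfolding split c_def dV using ints int_slack by simp
    have nonneg: "0 \<le> quad_cost M u v" for u v
      using M unfolding quad_cost_def pos_def_def by (cases "u - v = 0") (auto intro: less_imp_le)
    have "0 \<le> (\<integral>u. quad_cost M u (V u) \<partial>P)" by (intro integral_nonneg_AE) (simp add: nonneg)
    moreover have "transport_cost (quad_cost M) P V = ennreal (\<integral>u. quad_cost M u (V u) \<partial>P)"
      unfolding transport_cost_def by (intro nn_integral_eq_integral int_cost) (simp add: nonneg)
    moreover have "0 \<le> slack V u" if "u \<in> W" for u
      using fg[of u "V u"] that VW WK unfolding slack_def by auto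
    ultimately show ?thesis using int_slack int_eq by auto
  qed
  have "AE u in P. slack S u = 0"
    using AE_P AE_space
  proof eventually_elim
    case (elim u)
    then have "S u \<in> K" using SW WK spP by auto
    then show ?case using contact[OF elim(1), of "S u"] elim(2) by (simp add: slack_def)
  qed
  then have "(\<integral>u. slack S u \<partial>P) = 0" by (rule integral_eq_zero_AE)
  then have cS: "transport_cost (quad_cost M) P S = ennreal c" "0 \<le> c" using cost[OF S_map] by simp_all
  have slack_nn: "0 \<le> (\<integral>u. slack V u \<partial>P)" if "V \<in> transport_maps P U" for V
    using cost[OF that] spP by (intro integral_nonneg_AE) (auto intro!: AE_I2)
  have "ennreal c \<le> transport_cost (quad_cost M) P V" if "V \<in> transport_maps P U" for V
    using cost[OF that] slack_nn[OF that] by (auto intro!: ennreal_leI)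
  then have INF: "(INF V\<in>transport_maps P U. transport_cost (quad_cost M) P V) = ennreal c"
    using INF_lower[OF S_map, of "transport_cost (quad_cost M) P"] cS(1)
    by (intro antisym INF_greatest) simp_all
  have opt: "optimal_map (quad_cost M) P U S"
    unfolding optimal_map_def INF using S_map cS by simp
  have uniq: "AE u in P. V u = S u" if V: "optimal_map (quad_cost M) P U V" for V
  proof -
    have Vm: "V \<in> transport_maps P U" and "transport_cost (quad_cost M) P V = ennreal c"
      using V unfolding optimal_map_def INF by auto
    then have "(\<integral>u. slack V u \<partial>P) = 0"
      using cost[OF Vm] cS(2) by simp
    moreover have "AE u in P. 0 \<le> slack V u" using cost[OF Vm] spP by (intro AE_I2) simp
    ultimately have "AE u in P. slack V u = 0"
      using cost[OF Vm] integral_nonneg_eq_0_iff_AE[of P "slack V"] by simp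
    then show ?thesis
      using AE_P AE_space
    proof eventually_elim
      case (elim u)
      have "V u \<in> K"
        using Vm measurable_space[of V P U u] elim(4) spU WK by (auto simp: transport_maps_def)
      then have "V u = T u" using contact[OF elim(2), of "V u"] elim(1) by (simp add: slack_def)
      with elim(3) show ?case by simp
    qed
  qed
  show ?thesis using opt inv uniq unfolding U_def by blast
qed

theorem corollary4p23:
  fixes W X :: "(real ^ 'n) set"
    and Y :: "'b::euclidean_space set"
    and K :: "real ^ 'n \<Rightarrow> 'b measure"
    and \<eta> :: "real ^ 'n \<Rightarrow> real"
    and L :: real
    and PX :: "(real ^ 'n) measure"
    and \<phi> :: "real ^ 'n \<Rightarrow> real ^ 'n"
    and PWY :: "((real ^ 'n) \<times> 'b) measure"
    and PY :: "'b measure"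
    and PWgY :: "'b \<Rightarrow> (real ^ 'n) measure"
    and M :: "real ^ 'n ^ 'n"
  assumes W: "open W" "bounded W" "convex W" "W \<noteq> {}"
    and kernel: "K \<in> borel_on X \<rightarrow>\<^sub>M prob_algebra (borel_on Y)"
    and cost: "\<eta> \<in> borel_measurable (borel_on X)" "\<And>x. x \<in> X \<Longrightarrow> 0 \<le> \<eta> x"
    and capacity: "capacity_achieving (borel_on X) (borel_on Y) K \<eta> L PX"
    and phi: "\<phi> \<in> borel_on W \<rightarrow>\<^sub>M borel_on X" "distr (uniform_on W) (borel_on X) \<phi> = PX"
    and PWY: "PWY = joint_law (uniform_on W) (borel_on Y) (\<lambda>w. K (\<phi> w))"
    and PY: "PY = distr PWY (borel_on Y) snd"
    and PWgY: "regular_cond_law (borel_on W) (borel_on Y) PWY PWgY"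
    and finite_capacity: "mutual_info PX (borel_on Y) K < \<infinity>"
    and M: "pos_def M"
  shows "AE y in PY. \<exists>S. optimal_map (quad_cost M) (PWgY y) (uniform_on W) S \<and>
           borel_invertible_on W S \<and>
           (\<forall>T. optimal_map (quad_cost M) (PWgY y) (uniform_on W) T \<longrightarrow>
              (AE u in PWgY y. T u = S u))"
proof -
  have \<phi>: "\<phi> \<in> uniform_on W \<rightarrow>\<^sub>M borel_on X"
    using phi(1) by (simp cong: measurable_cong_sets add: sets_uniform_on)
  have "absolutely_continuous (PX \<Otimes>\<^sub>M output_law PX K) (joint_law PX (borel_on Y) K)"
    using finite_capacity unfolding mutual_info_def relative_entropy_def by (auto split: if_splits)
  then have ac: "AE y in PY. absolutely_continuous (uniform_on W) (PWgY y)"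
    unfolding PY PWY using PWgY
    by (intro AE_cond_law_absolutely_continuous[OF prob_space_uniform_on sets_uniform_on kernel \<phi>])
      (simp_all add: W phi(2) PWY)
  show ?thesis
    using ac AE_space
  proof eventually_elim
    case (elim y)
    have "PWgY y \<in> space (prob_algebra (borel_on W))"
      using PWgY elim(2) unfolding regular_cond_law_def PY by (auto dest: measurable_space)
    then show ?case
      using elim(1) W M by (intro ex_unique_invertible_optimal_map) (auto simp: space_prob_algebra)
  qed
qed

end
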